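(* Let $n\ge 1$ and let $L\in\mathbb{R}^{N\times N}$ be the weighted graph Laplacian of a graph that contains a connected spanning tree, with $L=L^T$. Let $U_{\mathrm{ref}}\in\mathcal{R}\mathcal{H}_\infty$ and $\Delta_0,\Delta_1,\dots,\Delta_n\in\mathcal{R}\mathcal{H}_\infty$. Then the perturbed serial consensus system $$(sI+L)^nX=U_{\mathrm{ref}}+\left(\sum_{k=0}^n\Delta_ks^kL^{n-k}\right)X$$ achieves $n$th order consensus if $$\|\Delta_0\|_{\mathcal{H}_\infty}+\|\Delta_n\|_{\mathcal{H}_\infty}+\sum_{k=1}^{n-1}\|\Delta_k\|_{\mathcal{H}_\infty}\sqrt{\frac{k^k}{n^n}(n-k)^{n-k}}<1.$$
   Context: A weighted graph on the vertex set $\mathcal{V}=\{1,\dots,N\}$ with edge set $\mathcal{E}$ is described by a nonnegative adjacency matrix $W$ with $w_{i,j}>0$ if and only if $(j,i)\in\mathcal{E}$; its graph Laplacian $L$ has entries $[L]_{i,j}=-w_{i,j}$ for $i\neq j$ and $[L]_{i,i}=\sum_{k\ne i}w_{i,k}$. The graph contains a connected spanning tree if there is a vertex $i$ from which there is a (directed) path to every other vertex $j$. $\mathcal{R}\mathcal{H}_\infty$ denotes the space of proper, real rational, stable transfer matrices, with norm $\|\cdot\|_{\mathcal{H}_\infty}$; here $U_{\mathrm{ref}}$ is an $N$-vector and each $\Delta_k$ is an $N\times N$ transfer matrix. $X=X(s)$ is the Laplace transform of $x(t)=(x_1(t),\dots,x_N(t))^T$. The system achieves $n$th order consensus if $\lim_{t\to\infty}|x_i^{(k)}(t)-x_j^{(k)}(t)|=0$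 for all $i,j\in\mathcal{V}$ and all $k\in\{0,1,\dots,n-1\}$, where $x_i^{(k)}$ is the $k$th time derivative of $x_i$. *)

theory Defs
  imports "HOL-Analysis.Analysis" "HOL-Computational_Algebra.Polynomial"
begin

(* The vertex set {1..N} is a finite type 'v with CARD('v) = N. *)

definition weighted_graph :: "('v \<times> 'v) set \<Rightarrow> real^'v^'v \<Rightarrow> bool" where
  "weighted_graph E W \<longleftrightarrow> (\<forall>i j. 0 \<le> W $ i $ j \<and> (0 < W $ i $ j \<longleftrightarrow> (j, i) \<in> E))"

definition graph_laplacian :: "real^'v^'v \<Rightarrow> real^'v^'v" where
  "graph_laplacian W =
     (\<chi> i j. if i = j then (\<Sum>k\<in>UNIV - {i}. W $ i $ k) else - W $ i $ j)"

definition contains_spanning_tree :: "('v \<times> 'v) set \<Rightarrow> bool" where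
  "contains_spanning_tree E \<longleftrightarrow> (\<exists>i. \<forall>j. j \<noteq> i \<longrightarrow> (i, j) \<in> E\<^sup>*)"

(* On the type 'a^'n^'n the library's power operator is entrywise; this is the power for
   the matrix product. *)
definition matrix_pow :: "'a::semiring_1^'n^'n \<Rightarrow> nat \<Rightarrow> 'a^'n^'n" where
  "matrix_pow A k = (((**) A) ^^ k) (mat 1)"

(* A transfer function is represented by its values. Stability is the absence of poles in the
   closed right half-plane, so only the values there matter; the values at other points are
   left unconstrained. *)
definition RH_inf :: "(complex \<Rightarrow> complex) set" where
  "RH_inf = {f. \<exists>p q :: real poly.
     q \<noteq> 0 \<and> degree p \<le> degree q \<and>
     (\<forall>s. poly (map_poly complex_of_real q) s = 0 \<longrightarrow> Re s < 0) \<and>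
     (\<forall>s. 0 \<le> Re s \<longrightarrow>
        f s = poly (map_poly complex_of_real p) s / poly (map_poly complex_of_real q) s)}"

definition RH_inf_vec :: "(complex \<Rightarrow> complex^'m) set" where
  "RH_inf_vec = {F. \<forall>i. (\<lambda>s. F s $ i) \<in> RH_inf}"

definition RH_inf_mat :: "(complex \<Rightarrow> complex^'n^'m) set" where
  "RH_inf_mat = {F. \<forall>i j. (\<lambda>s. F s $ i $ j) \<in> RH_inf}"

(* Supremum over the open right half-plane of the largest singular value, i.e. of the operator
   norm induced by the Euclidean norms. The supremum is over a bounded set for members of
   RH_inf_mat. *)
definition Hinf_norm :: "(complex \<Rightarrow> complex^'n^'m) \<Rightarrow> real" where
  "Hinf_norm F = (SUP s\<in>{s. 0 < Re s}. onorm ((*v) (F s)))"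

(* One-sided Laplace transform, converging (at least) for Re s > \<sigma>. The gauge integral over
   the half-line includes improper, conditionally convergent integrals. *)
definition has_laplace_transform ::
    "(real \<Rightarrow> real^'v) \<Rightarrow> (complex \<Rightarrow> complex^'v) \<Rightarrow> real \<Rightarrow> bool" where
  "has_laplace_transform x X \<sigma> \<longleftrightarrow>
     (\<forall>s i. \<sigma> < Re s \<longrightarrow>
        ((\<lambda>t. exp (- s * complex_of_real t) * complex_of_real (x t $ i)) has_integral X s $ i)
          {0..})"

(* deriv is total, so the existence of the derivatives up to order n - 1 at all positive times
   is made explicit. *)
definition achieves_consensus :: "nat \<Rightarrow> (real \<Rightarrow> real^'v) \<Rightarrow> bool" where
  "achieves_consensus n x \<longleftrightarrow>
     (\<forall>k i t. Suc k < n \<longrightarrow> 0 < t \<longrightarrow> (deriv ^^ k) (\<lambda>t. x t $ i) differentiable at t) \<and>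
     (\<forall>k<n. \<forall>i j.
        ((\<lambda>t. \<bar>(deriv ^^ k) (\<lambda>t. x t $ i) t - (deriv ^^ k) (\<lambda>t. x t $ j) t\<bar>) \<longlongrightarrow> 0) at_top)"

end

theory Submission
  imports Defs "HOL-Computational_Algebra.Fundamental_Theorem_Algebra"
begin

text \<open>Write \<open>Z = (sI + L)\<^sup>n X\<close>. The system then reads \<open>(I - S) Z = U_ref\<close> with the loop transfer matrix
\<open>S = (\<Sum>k\<le>n. \<Delta>\<^sub>k (s\<^sup>k L\<^sup>n\<^sup>-\<^sup>k (sI + L)\<^sup>-\<^sup>n))\<close>. Diagonalizing the symmetric matrix \<open>L\<close> reduces the inner factor to
the scalar functions \<open>s\<^sup>k x\<^sup>n\<^sup>-\<^sup>k / (s + x)\<^sup>n\<close>, one for each eigenvalue \<open>x \<ge> 0\<close>. For \<open>Re s > 0\<close> the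
inequality \<open>\<bar>s\<bar>\<^sup>2 + x\<^sup>2 \<le> \<bar>s + x\<bar>\<^sup>2\<close> and the weighted inequality of the arithmetic and geometric means
bound their modulus by the square roots that weight the norms of the perturbations
(\<open>cmod_modal_gain_le\<close>). Hence \<open>S\<close> is a contraction with a uniform constant below one, and \<open>I - S\<close> has
a proper stable inverse (\<open>proper_stable_solution\<close>), so that \<open>Z\<close> is proper and stable.

Undoing the substitution gives \<open>X = (\<Sum>m. q\<^sub>m \<zeta>\<^sub>m / (s + d\<^sub>m)\<^sup>n)\<close> with orthonormal eigenvectors \<open>q\<^sub>m\<close>, eigenvalues
\<open>d\<^sub>m \<ge> 0\<close> and proper stable \<open>\<zeta>\<^sub>m\<close> (\<open>transfer_solution\<close>). Every component is strictly proper, because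
\<open>n \<ge> 1\<close>. In a graph with a spanning tree the eigenvectors for the eigenvalue 0 are constant
(\<open>laplacian_kernel_constant\<close>), so they cancel in the differences \<open>X\<^sub>i - X\<^sub>j\<close>, and with them the poles
at the origin: these differences are strictly proper and stable.

Back in the time domain, a strictly proper rational function is the Laplace transform of a linear
combination of functions \<open>t\<^sup>k exp (a t)\<close>, where \<open>a\<close> runs through the poles. By the uniqueness of
the Laplace transform for continuous functions (\<open>laplace_unique\<close>), each \<open>x\<^sub>i\<close> coincides with such a combination
for \<open>t > 0\<close> and is therefore smooth there; each difference \<open>x\<^sub>i - x\<^sub>j\<close> coincides with one whose exponents have
negative real part, so that all its derivatives tend to 0.\<close>

section \<open>Rational functions without poles in the closed right half-plane\<close>

text \<open>As for \<open>RH_inf\<close>, only the values in the closed right half-plane are constrained. The coefficients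
may be complex, so that poles can be split off one at a time.\<close>

definition proper_stable :: "(complex \<Rightarrow> complex) \<Rightarrow> bool" where
  "proper_stable f \<longleftrightarrow> (\<exists>p q :: complex poly. q \<noteq> 0 \<and> degree p \<le> degree q \<and>
     (\<forall>s. poly q s = 0 \<longrightarrow> Re s < 0) \<and> (\<forall>s. 0 \<le> Re s \<longrightarrow> f s = poly p s / poly q s))"

lemma proper_stableI:
  assumes "q \<noteq> 0" "degree p \<le> degree q" "\<And>s. poly q s = 0 \<Longrightarrow> Re s < 0"
    "\<And>s. 0 \<le> Re s \<Longrightarrow> f s = poly p s / poly q s"
  shows "proper_stable f"
  using assms unfolding proper_stable_def by blast

lemma RH_inf_imp_proper_stable:
  assumes "f \<in> RH_inf" shows "proper_stable f"
proof -
  obtain p q :: "real poly" where pq: "q \<noteq> 0" "degree p \<le> degree q"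
    "\<forall>s. poly (map_poly complex_of_real q) s = 0 \<longrightarrow> Re s < 0"
    "\<forall>s. 0 \<le> Re s \<longrightarrow>
        f s = poly (map_poly complex_of_real p) s / poly (map_poly complex_of_real q) s"
    using assms unfolding RH_inf_def by blast
  show ?thesis
    by (rule proper_stableI[of "map_poly complex_of_real q" "map_poly complex_of_real p"])
      (use pq in \<open>auto simp: degree_map_poly map_poly_eq_0_iff\<close>)
qed


lemma proper_stable_const [intro]: "proper_stable (\<lambda>_. c)"
  by (rule proper_stableI[of 1 "[:c:]"]) auto

lemma proper_stable_add [intro]:
  assumes "proper_stable f" "proper_stable g" shows "proper_stable (\<lambda>s. f s + g s)"
proof -
  obtain p q where 1: "q \<noteq> 0" "degree p \<le> degree q" "\<forall>s. poly q s = 0 \<longrightarrow> Re s < 0"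
      "\<forall>s. 0 \<le> Re s \<longrightarrow> f s = poly p s / poly q s"
    using assms(1) unfolding proper_stable_def by blast
  obtain p' q' where 2: "q' \<noteq> 0" "degree p' \<le> degree q'" "\<forall>s. poly q' s = 0 \<longrightarrow> Re s < 0"
      "\<forall>s. 0 \<le> Re s \<longrightarrow> g s = poly p' s / poly q' s"
    using assms(2) unfolding proper_stable_def by blast
  show ?thesis
  proof (rule proper_stableI[of "q * q'" "p * q' + p' * q"])
    show "degree (p * q' + p' * q) \<le> degree (q * q')"
      using 1(1,2) 2(1,2) degree_mult_le[of p q'] degree_mult_le[of p' q]
      by (intro degree_add_le) (auto simp: degree_mult_eq)
    fix s :: complex assume s: "0 \<le> Re s"
    then have "poly q s \<noteq> 0" "poly q' s \<noteq> 0" using 1(3) 2(3) by force+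
    then show "f s + g s = poly (p * q' + p' * q) s / poly (q * q') s"
      using 1(4) 2(4) s by (simp add: field_simps)
  qed (use 1 2 in auto)
qed

lemma proper_stable_mult [intro]:
  assumes "proper_stable f" "proper_stable g" shows "proper_stable (\<lambda>s. f s * g s)"
proof -
  obtain p q where 1: "q \<noteq> 0" "degree p \<le> degree q" "\<forall>s. poly q s = 0 \<longrightarrow> Re s < 0"
      "\<forall>s. 0 \<le> Re s \<longrightarrow> f s = poly p s / poly q s"
    using assms(1) unfolding proper_stable_def by blast
  obtain p' q' where 2: "q' \<noteq> 0" "degree p' \<le> degree q'" "\<forall>s. poly q' s = 0 \<longrightarrow> Re s < 0"
      "\<forall>s. 0 \<le> Re s \<longrightarrow> g s = poly p' s / poly q' s"
    using assms(2) unfolding proper_stable_def by blast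
  show ?thesis
    by (rule proper_stableI[of "q * q'" "p * p'"])
      (use 1 2 degree_mult_le[of p p'] in \<open>auto simp: degree_mult_eq\<close>)
qed

lemma proper_stable_sum [intro]:
  "(\<And>i. i \<in> A \<Longrightarrow> proper_stable (f i)) \<Longrightarrow> proper_stable (\<lambda>s. \<Sum>i\<in>A. f i s)"
  by (induction A rule: infinite_finite_induct) auto

lemma proper_stable_prod [intro]:
  "(\<And>i. i \<in> A \<Longrightarrow> proper_stable (f i)) \<Longrightarrow> proper_stable (\<lambda>s. \<Prod>i\<in>A. f i s)"
  by (induction A rule: infinite_finite_induct) auto

lemma proper_stable_power [intro]:
  "proper_stable f \<Longrightarrow> proper_stable (\<lambda>s. f s ^ k)"
  by (induction k) auto

lemma proper_stable_diff [intro]: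
  "proper_stable f \<Longrightarrow> proper_stable g \<Longrightarrow> proper_stable (\<lambda>s. f s - g s)"
  using proper_stable_add[of f "\<lambda>s. (-1) * g s"] proper_stable_mult[of "\<lambda>_. -1" g] by auto

lemma proper_stable_lowpass:
  assumes "0 < Re a" shows "proper_stable (\<lambda>s. 1 / (s + a))"
  by (rule proper_stableI[of "[:a, 1:]" 1]) (use assms in \<open>auto simp: add.commute add_eq_0_iff2\<close>)

lemma proper_stable_highpass:
  assumes "0 < Re a" shows "proper_stable (\<lambda>s. s / (s + a))"
  by (rule proper_stableI[of "[:a, 1:]" "[:0,1:]"]) (use assms in \<open>auto simp: add.commute add_eq_0_iff2\<close>)

lemma proper_stable_det:
  fixes M :: "complex \<Rightarrow> complex^'n^'n"
  assumes "\<And>i j. proper_stable (\<lambda>s. M s $ i $ j)"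
  shows "proper_stable (\<lambda>s. det (M s))"
  unfolding det_def using assms by (intro proper_stable_sum proper_stable_mult proper_stable_prod) auto

text \<open>A pole can be split off by dividing the numerator by its linear factor with remainder. So the class
is generated from the constants by sums and by appending a stable pole.\<close>

lemma proper_stable_induct [consumes 1, case_names cong const add pole]:
  assumes f: "proper_stable f"
    and cong: "\<And>f g. P f \<Longrightarrow> (\<And>s. 0 \<le> Re s \<Longrightarrow> f s = g s) \<Longrightarrow> P g"
    and const: "\<And>c. P (\<lambda>_. c)"
    and add: "\<And>f g. P f \<Longrightarrow> P g \<Longrightarrow> P (\<lambda>s. f s + g s)"
    and pole: "\<And>f a. P f \<Longrightarrow> Re a < 0 \<Longrightarrow> P (\<lambda>s. f s / (s - a))"
  shows "P f"
proof -
  have *: "P (\<lambda>s. poly p s / poly q s)"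
    if "degree q = m" "q \<noteq> 0" "degree p \<le> m" "\<And>s. poly q s = 0 \<Longrightarrow> Re s < 0"
    for m and p q :: "complex poly"
    using that
  proof (induction m arbitrary: p q)
    case 0
    then obtain a b where "q = [:a:]" "p = [:b:]"
      by (metis degree_eq_zeroE le_zero_eq)
    then show ?case using const[of "b / a"] by simp
  next
    case (Suc m)
    obtain a where a: "poly q a = 0"
      using fundamental_theorem_of_algebra[of q] constant_degree[of q] Suc.prems(1) by auto
    then obtain q' where q: "q = [:-a, 1:] * q'"
      by (metis dvd_def poly_eq_0_iff_dvd)
    have q': "q' \<noteq> 0" using q Suc.prems by auto
    have "degree q = degree [:-a, 1:] + degree q'"
      unfolding q by (rule degree_mult_eq) (use q' in auto)
    then have deg: "degree q' = m" using Suc.prems(1) by simp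
    have roots: "Re s < 0" if "poly q' s = 0" for s
      using Suc.prems(4)[of s] that by (simp add: q)
    define p' where "p' = synthetic_div p a"
    have p: "p = [:-a, 1:] * p' + [:poly p a:]"
      using synthetic_div_correct'[of a p] by (simp add: p'_def)
    have "degree p' \<le> m"
      using Suc.prems(3) by (simp add: p'_def degree_synthetic_div)
    then have 1: "P (\<lambda>s. poly p' s / poly q' s)"
      using Suc.IH[OF deg q'] roots by blast
    have 2: "P (\<lambda>s. poly [:poly p a:] s / poly q' s)"
      using Suc.IH[OF deg q', of "[:poly p a:]"] roots by simp
    have a0: "Re a < 0" using Suc.prems(4) a by blast
    show ?case
    proof (rule cong[OF add[OF 1 pole[OF 2 a0]]])
      fix s :: complex assume s: "0 \<le> Re s"
      have sa: "s - a \<noteq> 0" using s a0 by auto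
      have qs: "poly q' s \<noteq> 0" using roots[of s] s by fastforce
      have ps: "poly p s = (s - a) * poly p' s + poly p a"
        by (subst p) (simp add: algebra_simps)
      show "poly p' s / poly q' s + poly [:poly p a:] s / poly q' s / (s - a) = poly p s / poly q s"
        using sa qs unfolding ps q by (simp add: divide_simps) (simp add: algebra_simps)
    qed
  qed
  show ?thesis
    using f unfolding proper_stable_def using * cong by (metis (no_types, lifting))
qed

text \<open>A pole \<open>a\<close> contributes a factor of modulus at most \<open>1 / \<bar>Re a\<bar>\<close> in the right half-plane.\<close>

lemma proper_stable_bounded:
  assumes "proper_stable f"
  shows "\<exists>B. \<forall>s. 0 \<le> Re s \<longrightarrow> cmod (f s) \<le> B"
  using assms
proof (induction rule: proper_stable_induct)
  case (cong f g) then show ?case by metis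
next
  case (const c) then show ?case by blast
next
  case (add f g)
  then obtain A B where "\<forall>s. 0 \<le> Re s \<longrightarrow> cmod (f s) \<le> A" "\<forall>s. 0 \<le> Re s \<longrightarrow> cmod (g s) \<le> B"
    by blast
  then show ?case by (intro exI[of _ "A + B"]) (auto intro: norm_triangle_mono)
next
  case (pole f a)
  then obtain B where B: "\<forall>s. 0 \<le> Re s \<longrightarrow> cmod (f s) \<le> B" by blast
  have "cmod (f s / (s - a)) \<le> B / (- Re a)" if "0 \<le> Re s" for s
  proof -
    have "- Re a \<le> cmod (s - a)"
      using abs_Re_le_cmod[of "s - a"] that by simp
    then show ?thesis
      unfolding norm_divide using B that pole(2) norm_ge_zero[of "f s"]
      by (intro frac_le) (auto intro: order_trans[OF norm_ge_zero])
  qed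
  then show ?case by blast
qed

text \<open>The lower bound excludes zeros of the numerator in the closed right half-plane and, by the
behaviour at infinity, a numerator of smaller degree than the denominator.\<close>

lemma proper_stable_inverse:
  assumes "proper_stable f" and c: "0 < c" "\<And>s. 0 < Re s \<Longrightarrow> c \<le> cmod (f s)"
  shows "proper_stable (\<lambda>s. 1 / f s)"
proof -
  obtain p q where 1: "q \<noteq> 0" "degree p \<le> degree q" "\<forall>s. poly q s = 0 \<longrightarrow> Re s < 0"
      "\<forall>s. 0 \<le> Re s \<longrightarrow> f s = poly p s / poly q s"
    using assms(1) unfolding proper_stable_def by blast
  have q0: "poly q s \<noteq> 0" if "0 \<le> Re s" for s using 1(3) that by force
  have le: "c * cmod (poly q s) \<le> cmod (poly p s)" if "0 < Re s" for s
    using c(2)[OF that] 1(4) that q0[of s] by (auto simp: norm_divide field_simps)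
  \<comment> \<open>By continuity the lower bound extends to the imaginary axis.\<close>
  have le': "c * cmod (poly q s) \<le> cmod (poly p s)" if "0 \<le> Re s" for s
  proof (rule tendsto_le)
    have *: "((\<lambda>t. poly r (s + of_real t)) \<longlongrightarrow> poly r (s + of_real 0)) (at_right 0)" for r
      by (intro tendsto_intros)
    show "((\<lambda>t. cmod (poly p (s + of_real t))) \<longlongrightarrow> cmod (poly p s)) (at_right 0)"
      using tendsto_norm[OF *[of p]] by simp
    show "((\<lambda>t. c * cmod (poly q (s + of_real t))) \<longlongrightarrow> c * cmod (poly q s)) (at_right 0)"
      using tendsto_mult_left[OF tendsto_norm[OF *[of q]]] by simp
    show "\<forall>\<^sub>F t in at_right 0. c * cmod (poly q (s + of_real t)) \<le> cmod (poly p (s + of_real t))"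
      using that by (intro eventually_at_rightI[of 0 1] le) auto
  qed simp
  have p0: "poly p s \<noteq> 0" if "0 \<le> Re s" for s
    using le'[OF that] q0[OF that] c(1) by (auto simp: mult_le_0_iff)
  then have p: "p \<noteq> 0" by (metis poly_0 order_refl zero_complex.sel(1))
  \<comment> \<open>Otherwise the quotient would tend to 0 along the positive reals.\<close>
  have "degree q \<le> degree p"
  proof (rule ccontr)
    assume "\<not> degree q \<le> degree p"
    then have "((\<lambda>x. poly p x / poly q x) \<longlongrightarrow> 0) at_infinity"
      by (intro poly_divide_tendsto_0_at_infinity) auto
    moreover have "filterlim complex_of_real at_infinity at_top"
      by (intro filterlim_of_real_at_infinity filterlim_ident)
    ultimately have "((\<lambda>t. poly p (of_real t) / poly q (of_real t)) \<longlongrightarrow> (0::complex)) at_top"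
      by (rule filterlim_compose)
    then have "\<forall>\<^sub>F t in at_top. cmod (poly p (of_real t) / poly q (of_real t)) < c"
      using c(1) by (auto simp: tendsto_iff dist_norm)
    then have "\<forall>\<^sub>F t :: real in at_top. False"
      using eventually_gt_at_top[of 0]
    proof eventually_elim
      case (elim t)
      then show False
        using le[of "of_real t"] q0[of "of_real t"] by (auto simp: norm_divide field_simps)
    qed
    then show False by simp
  qed
  then show ?thesis
    by (intro proper_stableI[of p q]) (use p p0 1(4) in \<open>auto simp: not_le[symmetric]\<close>)
qed

section \<open>Exponential polynomials and their Laplace transforms\<close>

text \<open>\<open>exp_poly c f F\<close> builds a linear combination \<open>f\<close> of functions \<open>t\<^sup>k exp (a t)\<close> with \<open>Re a < c\<close>
together with its Laplace transform \<open>F\<close>.\<close>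

inductive exp_poly :: "real \<Rightarrow> (real \<Rightarrow> complex) \<Rightarrow> (complex \<Rightarrow> complex) \<Rightarrow> bool" for c where
  monomial: "Re a < c \<Longrightarrow>
     exp_poly c (\<lambda>t. of_real t ^ k * exp (a * of_real t) / fact k) (\<lambda>s. 1 / (s - a) ^ Suc k)"
| add: "exp_poly c f F \<Longrightarrow> exp_poly c g G \<Longrightarrow> exp_poly c (\<lambda>t. f t + g t) (\<lambda>s. F s + G s)"
| scale: "exp_poly c f F \<Longrightarrow> exp_poly c (\<lambda>t. b * f t) (\<lambda>s. b * F s)"

lemma exp_poly_zero: "exp_poly c (\<lambda>_. 0) (\<lambda>_. 0)"
  using exp_poly.scale[OF exp_poly.monomial[of "of_real (c - 1)" c 0], of 0] by simp

text \<open>Transforms are compared only on the half-plane \<open>Re s \<ge> c\<close>, which contains no pole.\<close>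

definition is_exp_poly_transform :: "real \<Rightarrow> (complex \<Rightarrow> complex) \<Rightarrow> bool" where
  "is_exp_poly_transform c F \<longleftrightarrow> (\<exists>f G. exp_poly c f G \<and> (\<forall>s. c \<le> Re s \<longrightarrow> F s = G s))"

lemma transform_onI: "exp_poly c f F \<Longrightarrow> is_exp_poly_transform c F"
  unfolding is_exp_poly_transform_def by blast

lemma exp_poly_transform_cong:
  "is_exp_poly_transform c F \<Longrightarrow> (\<And>s. c \<le> Re s \<Longrightarrow> F s = G s) \<Longrightarrow> is_exp_poly_transform c G"
  unfolding is_exp_poly_transform_def by metis

lemma exp_poly_transform_add:
  assumes "is_exp_poly_transform c F" "is_exp_poly_transform c G"
  shows "is_exp_poly_transform c (\<lambda>s. F s + G s)"
proof -
  obtain f F' g G' where "exp_poly c f F'" "\<forall>s. c \<le> Re s \<longrightarrow> F s = F' s"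
    "exp_poly c g G'" "\<forall>s. c \<le> Re s \<longrightarrow> G s = G' s"
    using assms unfolding is_exp_poly_transform_def by blast
  then show ?thesis
    unfolding is_exp_poly_transform_def
    by (intro exI[of _ "\<lambda>t. f t + g t"] exI[of _ "\<lambda>s. F' s + G' s"]) (auto intro: exp_poly.add)
qed

lemma exp_poly_transform_scale:
  assumes "is_exp_poly_transform c F" shows "is_exp_poly_transform c (\<lambda>s. b * F s)"
proof -
  obtain f F' where "exp_poly c f F'" "\<forall>s. c \<le> Re s \<longrightarrow> F s = F' s"
    using assms unfolding is_exp_poly_transform_def by blast
  then show ?thesis
    unfolding is_exp_poly_transform_def
    by (intro exI[of _ "\<lambda>t. b * f t"] exI[of _ "\<lambda>s. b * F' s"]) (auto intro: exp_poly.scale)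
qed

lemma exp_poly_transform_zero: "is_exp_poly_transform c (\<lambda>_. 0)"
  using exp_poly_zero transform_onI by blast

lemma exp_poly_transform_sum:
  "(\<And>i. i \<in> A \<Longrightarrow> is_exp_poly_transform c (F i)) \<Longrightarrow> is_exp_poly_transform c (\<lambda>s. \<Sum>i\<in>A. F i s)"
  by (induction A rule: infinite_finite_induct) (auto intro: exp_poly_transform_zero exp_poly_transform_add)

lemma exp_poly_transform_monomial: "Re a < c \<Longrightarrow> is_exp_poly_transform c (\<lambda>s. 1 / (s - a) ^ Suc k)"
  using exp_poly.monomial transform_onI by blast

text \<open>Partial fractions: for \<open>a \<noteq> b\<close> the identity
\<open>1 / ((s - a) (s - b)) = (1 / (s - a) - 1 / (s - b)) / (a - b)\<close> lowers the order of the pole \<open>a\<close>.\<close>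

lemma exp_poly_transform_two_poles:
  assumes "Re a < c" "Re b < c"
  shows "is_exp_poly_transform c (\<lambda>s. 1 / (s - a) ^ Suc k / (s - b))"
proof (cases "a = b")
  case True
  then show ?thesis
    using exp_poly_transform_monomial[OF assms(1), of "Suc k"] by (simp add: mult.commute mult.left_commute)
next
  case False
  show ?thesis
  proof (induction k)
    case 0
    show ?case
    proof (rule exp_poly_transform_cong)
      show "is_exp_poly_transform c (\<lambda>s. 1/(a-b) * (1/(s-a) ^ Suc 0) + (-1/(a-b)) * (1/(s-b) ^ Suc 0))"
        by (intro exp_poly_transform_add exp_poly_transform_scale exp_poly_transform_monomial assms)
      fix s assume "c \<le> Re s"
      then have "s - a \<noteq> 0" "s - b \<noteq> 0" using assms by auto
      then show "1/(a-b) * (1/(s-a) ^ Suc 0) + (-1/(a-b)) * (1/(s-b) ^ Suc 0)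
          = 1 / (s - a) ^ Suc 0 / (s - b)"
        using False by (simp add: divide_simps)
    qed
  next
    case (Suc k)
    show ?case
    proof (rule exp_poly_transform_cong)
      show "is_exp_poly_transform c (\<lambda>s. 1/(a-b) * (1/(s-a) ^ Suc (Suc k))
          + (-1/(a-b)) * (1 / (s - a) ^ Suc k / (s - b)))"
        by (intro exp_poly_transform_add exp_poly_transform_scale exp_poly_transform_monomial assms Suc)
      fix s assume "c \<le> Re s"
      then have ne: "s - a \<noteq> 0" "s - b \<noteq> 0" using assms by auto
      define u where "u = (s - a) ^ Suc k"
      have "u \<noteq> 0" using ne by (simp add: u_def)
      moreover have "(s - a) ^ Suc (Suc k) = (s - a) * u" by (simp add: u_def)
      ultimately show "1/(a-b) * (1/(s-a) ^ Suc (Suc k)) + (-1/(a-b)) * (1 / (s - a) ^ Suc k / (s - b))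
          = 1 / (s - a) ^ Suc (Suc k) / (s - b)"
        using ne False unfolding u_def[symmetric] by (simp add: divide_simps)
    qed
  qed
qed

lemma exp_poly_transform_pole:
  assumes "is_exp_poly_transform c F" "Re b < c"
  shows "is_exp_poly_transform c (\<lambda>s. F s / (s - b))"
proof -
  obtain f G where fG: "exp_poly c f G" "\<forall>s. c \<le> Re s \<longrightarrow> F s = G s"
    using assms(1) unfolding is_exp_poly_transform_def by blast
  from fG(1) have "is_exp_poly_transform c (\<lambda>s. G s / (s - b))"
  proof (induction rule: exp_poly.induct)
    case (monomial a k) then show ?case using assms(2) by (rule exp_poly_transform_two_poles)
  next
    case (add f F g G) then show ?case by (simp add: add_divide_distrib exp_poly_transform_add)
  next
    case (scale f F d) then show ?case using exp_poly_transform_scale[of c _ d] by force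
  qed
  then show ?thesis by (rule exp_poly_transform_cong) (use fG(2) in auto)
qed

text \<open>This replaces a general inverse Laplace transform of strictly proper rational functions: the
factor \<open>F\<close> carries the strict properness, and the induction for \<open>R\<close> appends its poles.\<close>

lemma exp_poly_transform_proper_stable_mult:
  assumes "proper_stable R" "is_exp_poly_transform c F" "0 \<le> c"
  shows "is_exp_poly_transform c (\<lambda>s. R s * F s)"
  using assms(1)
proof (induction rule: proper_stable_induct)
  case (cong f g)
  from cong(1) show ?case by (rule exp_poly_transform_cong) (use cong(2) assms(3) in auto)
next
  case (const b) then show ?case using assms(2) by (rule exp_poly_transform_scale)
next
  case (add f g) then show ?case by (simp add: distrib_right exp_poly_transform_add)
next
  case (pole f a)
  then show ?case using exp_poly_transform_pole[of c "\<lambda>s. f s * F s" a] assms(3) by simp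
qed

lemma monomial_Suc_has_vector_derivative:
  fixes a :: complex
  shows "((\<lambda>t. of_real t ^ Suc j * exp (a * of_real t) / fact (Suc j)) has_vector_derivative
     of_real t ^ j * exp (a * of_real t) / fact j
     + a * (of_real t ^ Suc j * exp (a * of_real t) / fact (Suc j))) (at t within S)"
proof -
  let ?z = "complex_of_real t"
  have "((\<lambda>z. z ^ Suc j * exp (a * z) / fact (Suc j)) has_field_derivative
      (of_nat (Suc j) * ?z ^ j * exp (a * ?z) + ?z ^ Suc j * (a * exp (a * ?z))) / fact (Suc j)) (at ?z)"
  proof (rule DERIV_cdivide)
    have "((\<lambda>z. z ^ Suc j) has_field_derivative of_nat (Suc j) * ?z ^ j) (at ?z)"
      using DERIV_power[OF DERIV_ident[of "at ?z"], where n = "Suc j"] by simp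
    moreover have "((\<lambda>z. exp (a * z)) has_field_derivative a * exp (a * ?z)) (at ?z)"
      by (auto intro!: derivative_eq_intros)
    ultimately show "((\<lambda>z. z ^ Suc j * exp (a * z)) has_field_derivative
        of_nat (Suc j) * ?z ^ j * exp (a * ?z) + ?z ^ Suc j * (a * exp (a * ?z))) (at ?z)"
      using DERIV_mult by (fastforce simp: algebra_simps)
  qed
  moreover have "(of_nat (Suc j) * ?z ^ j * exp (a * ?z) + ?z ^ Suc j * (a * exp (a * ?z))) / fact (Suc j)
      = ?z ^ j * exp (a * ?z) / fact j + a * (?z ^ Suc j * exp (a * ?z) / fact (Suc j))"
  proof -
    have "of_nat (Suc j) * X / fact (Suc j) = X / fact j" for X :: complex
      by (simp only: fact_Suc of_nat_mult) (simp del: of_nat_Suc)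
    then show ?thesis
      by (simp add: add_divide_distrib mult.assoc mult.left_commute del: of_nat_Suc fact_Suc power_Suc)
  qed
  ultimately show ?thesis
    by (intro has_vector_derivative_real_field) (simp only:)
qed

lemma exp_poly_deriv:
  assumes "exp_poly c f F"
  shows "\<exists>f' F'. exp_poly c f' F' \<and> (\<forall>t. (f has_vector_derivative f' t) (at t))"
  using assms
proof (induction rule: exp_poly.induct)
  case (monomial a k)
  show ?case
  proof (cases k)
    case 0
    have "((\<lambda>t. of_real t ^ k * exp (a * of_real t) / fact k) has_vector_derivative
            a * (of_real t ^ k * exp (a * of_real t) / fact k)) (at t)" for t :: real
      unfolding 0
      by (auto intro!: derivative_eq_intros has_vector_derivative_real_field)
    then show ?thesis using exp_poly.scale[OF exp_poly.monomial[OF monomial, of k], of a] by blast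
  next
    case (Suc j)
    have "((\<lambda>t. of_real t ^ k * exp (a * of_real t) / fact k) has_vector_derivative
            of_real t ^ j * exp (a * of_real t) / fact j
            + a * (of_real t ^ k * exp (a * of_real t) / fact k)) (at t)" for t :: real
      unfolding Suc by (rule monomial_Suc_has_vector_derivative)
    then show ?thesis
      using exp_poly.add[OF exp_poly.monomial[OF monomial, of j]
          exp_poly.scale[OF exp_poly.monomial[OF monomial, of k], of a]] by blast
  qed
next
  case (add f F g G)
  then obtain f' F' g' G' where "exp_poly c f' F'" "exp_poly c g' G'"
    "\<forall>t. (f has_vector_derivative f' t) (at t)" "\<forall>t. (g has_vector_derivative g' t) (at t)"
    by blast
  then show ?case using exp_poly.add[of c f' F' g' G'] by (blast intro: has_vector_derivative_add)
next
  case (scale f F b)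
  then obtain f' F' where "exp_poly c f' F'" "\<forall>t. (f has_vector_derivative f' t) (at t)"
    by blast
  then show ?case using exp_poly.scale[of c f' F' b]
    by (blast intro: has_vector_derivative_mult_right)
qed

lemma power_times_exp_tendsto_0:
  assumes "0 < r" shows "((\<lambda>t::real. t ^ k * exp (- r * t)) \<longlongrightarrow> 0) at_top"
proof -
  have "filterlim (\<lambda>t. r * t) at_top at_top"
    using assms by (intro filterlim_tendsto_pos_mult_at_top[OF tendsto_const]) (auto simp: filterlim_ident)
  then have "((\<lambda>t. (r * t) ^ k / exp (r * t)) \<longlongrightarrow> 0) at_top"
    by (rule filterlim_compose[OF tendsto_power_div_exp_0])
  then have "((\<lambda>t. (1 / r ^ k) * ((r * t) ^ k / exp (r * t))) \<longlongrightarrow> (1 / r ^ k) * 0) at_top"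
    by (rule tendsto_mult_left)
  then show ?thesis
    using assms by (simp add: power_mult_distrib exp_minus field_simps)
qed

lemma monomial_tendsto_0:
  assumes "Re a < 0"
  shows "((\<lambda>t. of_real t ^ k * exp (a * of_real t) / fact k) \<longlongrightarrow> (0::complex)) at_top"
proof (rule Lim_null_comparison)
  show "((\<lambda>t. (t ^ k * exp (- (- Re a) * t)) / fact k) \<longlongrightarrow> 0) at_top"
    using tendsto_divide_zero[OF power_times_exp_tendsto_0[of "- Re a" k]] assms by simp
  show "\<forall>\<^sub>F t in at_top. norm (of_real t ^ k * exp (a * of_real t) / fact k :: complex)
      \<le> t ^ k * exp (- (- Re a) * t) / fact k"
    using eventually_ge_at_top[of 0]
    by eventually_elim (simp add: norm_divide norm_mult norm_power)
qed

lemma exp_poly_tendsto_0: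
  assumes "exp_poly 0 f F" shows "(f \<longlongrightarrow> 0) at_top"
  using assms
proof (induction rule: exp_poly.induct)
  case (monomial a k) then show ?case by (rule monomial_tendsto_0)
next
  case (add f F g G) then show ?case using tendsto_add[of f 0 _ g 0] by simp
next
  case (scale f F b) show ?case using scale.IH by (rule tendsto_mult_right_zero)
qed

lemma exp_poly_continuous:
  assumes "exp_poly c f F" shows "continuous_on S f"
proof -
  obtain f' where "\<And>t. (f has_vector_derivative f' t) (at t)"
    using exp_poly_deriv[OF assms] by blast
  then show ?thesis
    by (intro continuous_at_imp_continuous_on ballI has_vector_derivative_continuous)
qed

text \<open>Integration by parts lowers \<open>k\<close>; the boundary terms vanish in the limit. Improper integrals appear as
limits of integrals over \<open>{0..T}\<close>, which is the form in which the uniqueness theorem uses them.\<close>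

lemma monomial_laplace:
  assumes "0 < Re w"
  shows "((\<lambda>T. integral {0..T} (\<lambda>t. of_real t ^ k * exp (- w * of_real t) / fact k))
    \<longlongrightarrow> 1 / w ^ Suc k) at_top"
proof -
  define f where "f k t = of_real t ^ k * exp (- w * of_real t) / fact k" for k and t :: real
  have f: "continuous_on {0..T} (f k)" for k T
    unfolding f_def by (intro continuous_intros) auto
  have lim: "(f k \<longlongrightarrow> 0) at_top" for k
    unfolding f_def using monomial_tendsto_0[of "-w" k] assms by simp
  have int: "f k integrable_on {0..T}" for k T
    using f by (rule integrable_continuous_real)
  have w: "w \<noteq> 0" using assms by auto
  have "((\<lambda>T. integral {0..T} (f k)) \<longlongrightarrow> 1 / w ^ Suc k) at_top"
  proof (induction k)
    case 0
    have "integral {0..T} (f 0) = (1 - f 0 T) / w" if "0 \<le> T" for T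
    proof -
      have "((\<lambda>t. - w * f 0 t) has_integral f 0 T - f 0 0) {0..T}"
        using that
      proof (rule fundamental_theorem_of_calculus)
        fix x show "(f 0 has_vector_derivative - w * f 0 x) (at x within {0..T})"
          unfolding f_def
          by (rule has_vector_derivative_real_field, (rule derivative_eq_intros refl | simp)+)
      qed
      then have "- w * integral {0..T} (f 0) = f 0 T - f 0 0"
        by (metis integral_unique integral_mult_right)
      then show ?thesis using w by (simp add: f_def field_simps)
    qed
    then have "\<forall>\<^sub>F T in at_top. (1 - f 0 T) / w = integral {0..T} (f 0)"
      by (intro eventually_at_top_linorderI[of 0]) simp
    moreover have "((\<lambda>T. (1 - f 0 T) / w) \<longlongrightarrow> (1 - 0) / w) at_top"
      by (intro tendsto_intros lim w)
    ultimately show ?case by (simp add: tendsto_cong)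
  next
    case (Suc k)
    have "integral {0..T} (f (Suc k)) = (integral {0..T} (f k) - f (Suc k) T) / w" if "0 \<le> T" for T
    proof -
      have "((\<lambda>t. f k t - w * f (Suc k) t) has_integral f (Suc k) T - f (Suc k) 0) {0..T}"
        using that
      proof (rule fundamental_theorem_of_calculus)
        fix x show "(f (Suc k) has_vector_derivative f k x - w * f (Suc k) x) (at x within {0..T})"
          using monomial_Suc_has_vector_derivative[of k "- w" x "{0..T}"] unfolding f_def
          by (simp del: fact_Suc power_Suc)
      qed
      moreover have "integral {0..T} (\<lambda>t. f k t - w * f (Suc k) t)
          = integral {0..T} (f k) - w * integral {0..T} (f (Suc k))"
        by (subst integral_diff) (auto intro!: int integrable_on_mult_right)
      ultimately have "integral {0..T} (f k) - w * integral {0..T} (f (Suc k)) = f (Suc k) T - f (Suc k) 0"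
        by (metis integral_unique)
      then show ?thesis using w by (simp add: f_def field_simps)
    qed
    then have "\<forall>\<^sub>F T in at_top. (integral {0..T} (f k) - f (Suc k) T) / w = integral {0..T} (f (Suc k))"
      by (intro eventually_at_top_linorderI[of 0]) simp
    moreover have "((\<lambda>T. (integral {0..T} (f k) - f (Suc k) T) / w) \<longlongrightarrow> (1 / w ^ Suc k - 0) / w) at_top"
      by (intro tendsto_intros lim w Suc)
    ultimately show ?case by (simp add: tendsto_cong field_simps)
  qed
  then show ?thesis unfolding f_def .
qed

lemma exp_poly_laplace:
  assumes "exp_poly c f F" "c \<le> Re s"
  shows "((\<lambda>T. integral {0..T} (\<lambda>t. exp (- s * of_real t) * f t)) \<longlongrightarrow> F s) at_top"
  using assms(1)
proof (induction rule: exp_poly.induct)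
  case (monomial a k)
  have eq: "exp (- s * of_real t) * (of_real t ^ k * exp (a * of_real t) / fact k)
      = of_real t ^ k * exp (- (s - a) * of_real t) / fact k" for t
  proof -
    have "- (s - a) * of_real t = - s * of_real t + a * of_real t" by (simp add: algebra_simps)
    then show ?thesis by (simp only: exp_add) (simp add: field_simps)
  qed
  have "0 < Re (s - a)" using monomial assms(2) by simp
  from monomial_laplace[OF this, of k] show ?case unfolding eq .
next
  case (add f F g G)
  have "(\<lambda>t. exp (- s * of_real t) * f t) integrable_on {0..T}"
    "(\<lambda>t. exp (- s * of_real t) * g t) integrable_on {0..T}" for T
    by (intro integrable_continuous_real continuous_intros
        exp_poly_continuous[OF add.hyps(1)] exp_poly_continuous[OF add.hyps(2)])+
  then show ?case
    using tendsto_add[OF add.IH] by (simp add: distrib_left integral_add)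
next
  case (scale f F b)
  show ?case using tendsto_mult_left[OF scale.IH, of b] by (simp add: mult.left_commute)
qed

section \<open>Uniqueness of the Laplace transform\<close>

text \<open>The gauge integral over the half-line is tested on large intervals, in particular on
\<open>{-T..T}\<close>; so it is a limit of integrals over \<open>{0..T}\<close> also without absolute convergence.\<close>

lemma has_integral_half_line_tendsto:
  fixes f :: "real \<Rightarrow> 'a::euclidean_space"
  assumes "(f has_integral I) {0..}"
  shows "f integrable_on {0..T}" "((\<lambda>T. integral {0..T} f) \<longlongrightarrow> I) at_top"
proof -
  let ?g = "\<lambda>x. if x \<in> {0..} then f x else 0"
  have A: "\<forall>a b. ?g integrable_on cbox a b"
    and B: "\<forall>e>0. \<exists>B>0. \<forall>a b. ball 0 B \<subseteq> cbox a b \<longrightarrow> norm (integral (cbox a b) ?g - I) < e"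
    using assms unfolding has_integral_alt' by blast+
  have g: "?g integrable_on {-S..T}" for S T using A by (simp add: cbox_interval)
  have *: "{0..} \<inter> {-S..T} = {0..T}" if "0 \<le> S" for S T :: real using that by auto
  show "f integrable_on {0..T}"
    using g[of 0 T] integrable_restrict_Int[of "{0..}" f "{0..T}"] *[of 0 T]
    by (simp only: neg_0_equal_iff_equal order_refl minus_zero)
  have eq: "integral {-T..T} ?g = integral {0..T} f" if "0 \<le> T" for T
    using integral_restrict_Int[of "{-T..T}" "{0..}" f] unfolding *[OF that, of T] by (simp only:)
  show "((\<lambda>T. integral {0..T} f) \<longlongrightarrow> I) at_top"
    unfolding tendsto_iff
  proof (intro allI impI)
    fix e :: real assume "0 < e"
    then obtain R where R: "0 < R" "\<forall>a b. ball 0 R \<subseteq> cbox a b \<longrightarrow> norm (integral (cbox a b) ?g - I) < e"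
      using B by blast
    show "\<forall>\<^sub>F T in at_top. dist (integral {0..T} f) I < e"
    proof (rule eventually_at_top_linorderI[of R])
      fix T assume T: "R \<le> T"
      have "ball 0 R \<subseteq> cbox (-T) T" using T by (auto simp: dist_real_def)
      then have "norm (integral (cbox (-T) T) ?g - I) < e" using R by blast
      then show "dist (integral {0..T} f) I < e"
        using eq[of T] T R(1) by (simp add: dist_norm cbox_interval)
    qed
  qed
qed

text \<open>Approximating \<open>\<phi>\<close> uniformly by polynomials, to which it is orthogonal, shows that the integral of
\<open>\<phi>\<^sup>2\<close> is arbitrarily small.\<close>

lemma all_moments_zero_imp_zero:
  fixes \<phi> :: "real \<Rightarrow> real"
  assumes cont: "continuous_on {0..1} \<phi>"
    and mom: "\<And>m::nat. integral {0..1} (\<lambda>v. v ^ m * \<phi> v) = 0"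
    and v: "v \<in> {0..1}"
  shows "\<phi> v = 0"
proof -
  have int: "g integrable_on {0..1}" if "continuous_on {0..1} g" for g :: "real \<Rightarrow> real"
    using that by (rule integrable_continuous_real)
  have polz: "integral {0..1} (\<lambda>v. p v * \<phi> v) = 0" if p: "real_polynomial_function p" for p
  proof -
    obtain a n where "p = (\<lambda>x. \<Sum>i\<le>n. a i * x ^ i)"
      using p real_polynomial_function_iff_sum by blast
    then have "integral {0..1} (\<lambda>v. p v * \<phi> v) = integral {0..1} (\<lambda>v. \<Sum>i\<le>n. a i * (v ^ i * \<phi> v))"
      by (simp add: sum_distrib_right mult.assoc)
    also have "\<dots> = (\<Sum>i\<le>n. integral {0..1} (\<lambda>v. a i * (v ^ i * \<phi> v)))"
      by (rule integral_sum) (auto intro!: int continuous_intros cont)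
    also have "\<dots> = 0" by (simp add: mom)
    finally show ?thesis .
  qed
  obtain B where "0 < B" "\<forall>y\<in>\<phi> ` {0..1}. norm y \<le> B"
    using compact_imp_bounded[OF compact_continuous_image[OF cont]] unfolding bounded_pos by auto
  then have B: "\<And>v. v \<in> {0..1} \<Longrightarrow> \<bar>\<phi> v\<bar> \<le> B" "0 < B" by auto
  have "integral {0..1} (\<lambda>v. \<phi> v * \<phi> v) \<le> e * B" if e: "0 < e" for e
  proof -
    obtain p where p: "real_polynomial_function p" "\<And>x. x \<in> {0..1} \<Longrightarrow> \<bar>\<phi> x - p x\<bar> < e"
      using Stone_Weierstrass_real_polynomial_function[OF _ cont e] by auto
    have pc: "continuous_on {0..1} p"
      using p(1) by (simp add: continuous_on_polymonial_function real_polynomial_function_eq)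
    have "integral {0..1} (\<lambda>v. \<phi> v * \<phi> v) = integral {0..1} (\<lambda>v. \<phi> v * \<phi> v) - integral {0..1} (\<lambda>v. p v * \<phi> v)"
      using polz[OF p(1)] by simp
    also have "\<dots> = integral {0..1} (\<lambda>v. (\<phi> v - p v) * \<phi> v)"
      by (subst integral_diff[symmetric]) (auto intro!: int continuous_intros cont pc simp: algebra_simps)
    also have "\<dots> \<le> integral {0..1} (\<lambda>v::real. e * B)"
    proof (rule integral_le)
      fix v :: real assume v: "v \<in> {0..1}"
      have "(\<phi> v - p v) * \<phi> v \<le> \<bar>\<phi> v - p v\<bar> * \<bar>\<phi> v\<bar>" by (metis abs_ge_self abs_mult)
      also have "\<dots> \<le> e * B" using p(2)[OF v] B(1)[OF v] e by (intro mult_mono) auto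
      finally show "(\<phi> v - p v) * \<phi> v \<le> e * B" .
    qed (auto intro!: int continuous_intros cont pc)
    finally show ?thesis by simp
  qed
  note small = this
  have "integral {0..1} (\<lambda>v. \<phi> v * \<phi> v) \<le> 0"
  proof (rule field_le_epsilon)
    fix e :: real assume "0 < e"
    then show "integral {0..1} (\<lambda>v. \<phi> v * \<phi> v) \<le> 0 + e"
      using small[of "e / B"] B(2) by simp
  qed
  moreover have "0 \<le> integral {0..1} (\<lambda>v. \<phi> v * \<phi> v)"
    by (intro integral_nonneg int continuous_intros cont) auto
  ultimately have "((\<lambda>v. \<phi> v * \<phi> v) has_integral 0) (cbox 0 1)"
    using int[of "\<lambda>v. \<phi> v * \<phi> v"] cont by (auto simp: has_integral_iff cbox_interval intro!: continuous_intros)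
  then have "\<phi> v * \<phi> v = 0"
    by (rule has_integral_0_cbox_imp_0[rotated 2]) (use v cont in \<open>auto intro!: continuous_intros\<close>)
  then show ?thesis by simp
qed

text \<open>The substitution \<open>v = exp (-t)\<close> turns the Laplace transform at \<open>1, 2, 3, \<dots>\<close> into the moments
of the function \<open>G (- ln v)\<close> on the unit interval. That function is continuous also at \<open>v = 0\<close>, because \<open>G\<close> tends to 0.\<close>

lemma laplace_tail_moments:
  fixes G :: "real \<Rightarrow> real"
  assumes cont: "continuous_on {0..} G" and lim: "(G \<longlongrightarrow> 0) at_top"
    and mom: "\<And>m::nat. ((\<lambda>T. integral {0..T} (\<lambda>t. exp (- (real (Suc m)) * t) * G t)) \<longlongrightarrow> 0) at_top"
    and t: "0 \<le> t"
  shows "G t = 0"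
proof -
  define \<phi> where "\<phi> v = (if v \<le> 0 then 0 else G (- ln v))" for v
  have phi: "\<phi> (exp (- u)) = G u" for u by (simp add: \<phi>_def)
  have cphi: "continuous_on {0..1} \<phi>"
  proof -
    have 1: "continuous (at v within {0..1}) \<phi>" if v: "v \<in> {0<..1}" for v
    proof -
      have "continuous_on {0<..1} (\<lambda>v. G (- ln v))"
        by (rule continuous_on_compose2[OF cont]) (auto intro!: continuous_intros)
      then have "continuous_on {0<..1} \<phi>"
        by (rule continuous_on_eq) (auto simp: \<phi>_def)
      then have "continuous (at v within {0<..1}) \<phi>"
        using v by (simp add: continuous_on_eq_continuous_within)
      moreover have "at v within {0..1} = at v within {0<..1}"
        using v by (intro at_within_nhd[of v "{0<..}"]) auto
      ultimately show ?thesis by simp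
    qed
    have "filterlim (\<lambda>v::real. - ln v) at_top (at_right 0)"
      using ln_at_0 by (simp add: filterlim_uminus_at_top)
    then have "((\<lambda>v. G (- ln v)) \<longlongrightarrow> 0) (at_right 0)"
      by (rule filterlim_compose[OF lim])
    then have "(\<phi> \<longlongrightarrow> 0) (at_right 0)"
      by (rule Lim_transform_eventually)
        (auto simp: \<phi>_def eventually_at_filter)
    then have "(\<phi> \<longlongrightarrow> 0) (at 0 within {0..1})"
      using at_within_Icc_at_right[of 0 "1::real"] by simp
    then have "continuous (at 0 within {0..1}) \<phi>"
      by (simp add: continuous_within \<phi>_def)
    then show ?thesis
      unfolding continuous_on_eq_continuous_within
      by (metis "1" atLeastAtMost_iff greaterThanAtMost_iff order_le_less)
  qed
  have momphi: "integral {0..1} (\<lambda>v. v ^ m * \<phi> v) = 0" for m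
  proof -
    let ?h = "\<lambda>v. v ^ m * \<phi> v"
    have ch: "continuous_on {0..1} ?h" by (intro continuous_intros cphi)
    have sub: "integral {0..T} (\<lambda>t. exp (- (real (Suc m)) * t) * G t) = integral {exp (- T)..1} ?h"
      if T: "0 \<le> T" for T
    proof -
      have "((\<lambda>u. (- exp (- u)) *\<^sub>R ?h (exp (- u))) has_integral
          (integral {exp (- 0)..exp (- T)} ?h - integral {exp (- T)..exp (- 0)} ?h)) {0..T}"
        using ch
        by (intro has_integral_substitution_general[of "{}" _ _ "\<lambda>u. exp (- u)" 0 1 ?h])
          (use T in \<open>auto intro!: derivative_eq_intros continuous_intros\<close>)
      moreover have "integral {exp (- 0)..exp (- T)} ?h = 0"
        using T by (cases "T = 0") auto
      moreover have "(- exp (- u)) *\<^sub>R ?h (exp (- u)) = - (exp (- (real (Suc m)) * u) * G u)" for u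
        by (simp add: phi exp_of_nat_mult[symmetric] exp_add[symmetric] algebra_simps)
      ultimately have "((\<lambda>u. - (exp (- (real (Suc m)) * u) * G u)) has_integral
          - integral {exp (- T)..1} ?h) {0..T}"
        by simp
      from has_integral_neg[OF this] show ?thesis by (simp add: integral_unique)
    qed
    have "((\<lambda>T. integral {exp (- T)..1} ?h) \<longlongrightarrow> integral {0..1} ?h) at_top"
    proof -
      have "continuous_on {0..1} (\<lambda>x. integral {x..1} ?h)"
        by (rule indefinite_integral_continuous_1') (intro integrable_continuous_real ch)
      then have "((\<lambda>x. integral {x..1} ?h) \<longlongrightarrow> integral {0..1} ?h) (at 0 within {0..1})"
        by (simp add: continuous_on_def)
      moreover have "filterlim (\<lambda>T::real. exp (- T)) (at 0 within {0..1}) at_top"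
      proof -
        have "((\<lambda>T::real. exp (- T)) \<longlongrightarrow> 0) at_top"
          by (intro filterlim_compose[OF exp_at_bot] filterlim_uminus_at_bot_at_top)
        moreover have "\<forall>\<^sub>F T::real in at_top. exp (- T) \<in> {0..1} \<and> exp (- T) \<noteq> 0"
          by (intro eventually_at_top_linorderI[of 0]) auto
        ultimately show ?thesis by (simp add: filterlim_at)
      qed
      ultimately show ?thesis by (rule filterlim_compose)
    qed
    moreover have "((\<lambda>T. integral {exp (- T)..1} ?h) \<longlongrightarrow> 0) at_top"
      by (rule Lim_transform_eventually[OF mom[of m]])
        (use sub in \<open>auto intro!: eventually_at_top_linorderI[of 0]\<close>)
    ultimately show ?thesis
      by (rule tendsto_unique[OF trivial_limit_at_top_linorder])
  qed
  have "\<phi> (exp (- t)) = 0"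
    by (rule all_moments_zero_imp_zero[OF cphi momphi]) (use t in auto)
  then show ?thesis by (simp add: phi)
qed

text \<open>Lerch's theorem. The integral of \<open>h\<close> need not converge absolutely. The primitive \<open>G\<close> of
\<open>exp (- s0 t) h t\<close>, on the other hand, is continuous and tends to 0, and integration by parts shows that its Laplace
transform vanishes at the positive integers.\<close>

lemma laplace_unique:
  fixes h :: "real \<Rightarrow> real"
  assumes cont: "continuous_on {0<..} h"
    and int: "\<And>T. (\<lambda>t. exp (- s0 * t) * h t) integrable_on {0..T}"
    and lim: "\<And>s. s0 \<le> s \<Longrightarrow> ((\<lambda>T. integral {0..T} (\<lambda>t. exp (- s * t) * h t)) \<longlongrightarrow> 0) at_top"
    and t: "0 < t"
  shows "h t = 0"
proof -
  let ?g = "\<lambda>t. exp (- s0 * t) * h t"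
  define G where "G T = integral {0..T} ?g" for T
  have Gc: "continuous_on {0..T} G" for T
    unfolding G_def by (rule indefinite_integral_continuous_1[OF int])
  have gc: "continuous_on {0<..} ?g" by (intro continuous_intros cont)
  have Gd: "(G has_vector_derivative ?g u) (at u)" if u: "0 < u" for u
  proof -
    have "isCont ?g u"
      by (rule continuous_on_interior[OF gc]) (use u in \<open>simp add: interior_open\<close>)
    then have g: "continuous (at u within {0..u+1} - {}) ?g"
      by (rule continuous_at_imp_continuous_at_within)
    have "(G has_vector_derivative ?g u) (at u within {0..u+1} - {})"
      unfolding G_def
      by (rule integral_has_vector_derivative_continuous_at[OF int[of "u+1"] _ _ g]) (use u in auto)
    then show ?thesis using at_within_Icc_at[of 0 u "u+1"] u by auto
  qed
  have G0: "G 0 = 0" by (simp add: G_def)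
  have Glim: "(G \<longlongrightarrow> 0) at_top" unfolding G_def using lim[of s0] by simp
  have Gz: "G u = 0" if "0 \<le> u" for u
  proof (rule laplace_tail_moments[OF _ Glim _ that])
    show "continuous_on {0..} G"
      unfolding continuous_on_eq_continuous_within
    proof
      fix x :: real assume x: "x \<in> {0..}"
      have "continuous (at x within {0..x+1}) G"
        using Gc[of "x+1"] x by (simp add: continuous_on_eq_continuous_within)
      moreover have "at x within {0..} = at x within {0..x+1}"
        using x by (intro at_within_nhd[of x "{..<x+1}"]) auto
      ultimately show "continuous (at x within {0..}) G" by simp
    qed
    fix m :: nat
    let ?k = "real (Suc m)"
    have parts: "integral {0..T} (\<lambda>t. exp (- ?k * t) * G t)
        = (integral {0..T} (\<lambda>t. exp (- (s0 + ?k) * t) * h t) - exp (- ?k * T) * G T) / ?k"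
      if T: "0 \<le> T" for T
    proof -
      have i1: "(\<lambda>t. exp (- ?k * t) * G t) integrable_on {0..T}"
        by (intro integrable_continuous_real continuous_intros Gc)
      have "((\<lambda>t. exp (- ?k * t) * ?g t - ?k * (exp (- ?k * t) * G t)) has_integral
          exp (- ?k * T) * G T - exp (- ?k * 0) * G 0) {0..T}"
      proof (rule fundamental_theorem_of_calculus_interior[OF T])
        show "continuous_on {0..T} (\<lambda>t. exp (- ?k * t) * G t)"
          by (intro continuous_intros Gc)
        fix x assume "x \<in> {0<..<T}"
        then have "(G has_vector_derivative ?g x) (at x)" using Gd by auto
        moreover have "((\<lambda>t. exp (- ?k * t)) has_vector_derivative - ?k * exp (- ?k * x)) (at x)"
          by (auto intro!: derivative_eq_intros simp: has_real_derivative_iff_has_vector_derivative[symmetric])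
        ultimately show "((\<lambda>t. exp (- ?k * t) * G t) has_vector_derivative
            exp (- ?k * x) * ?g x - ?k * (exp (- ?k * x) * G x)) (at x)"
          using has_vector_derivative_mult by (fastforce simp: algebra_simps)
      qed
      from has_integral_add[OF this has_integral_mult_right[OF integrable_integral[OF i1], of ?k]]
      have I: "((\<lambda>t. exp (- ?k * t) * ?g t) has_integral
          exp (- ?k * T) * G T + ?k * integral {0..T} (\<lambda>t. exp (- ?k * t) * G t)) {0..T}"
        by (simp add: G0)
      have eq: "exp (- ?k * t) * ?g t = exp (- (s0 + ?k) * t) * h t" for t
      proof -
        have "- (s0 + ?k) * t = - ?k * t + - s0 * t" by (simp add: algebra_simps)
        then show ?thesis by (simp only: exp_add mult.assoc)
      qed
      have "integral {0..T} (\<lambda>t. exp (- (s0 + ?k) * t) * h t)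
          = exp (- ?k * T) * G T + ?k * integral {0..T} (\<lambda>t. exp (- ?k * t) * G t)"
        using integral_unique[OF I] unfolding eq .
      then show ?thesis by (simp add: field_simps)
    qed
    have e0: "((\<lambda>T. exp (- ?k * T)) \<longlongrightarrow> 0) at_top"
      by (intro filterlim_compose[OF exp_at_bot] filterlim_tendsto_neg_mult_at_bot[OF tendsto_const])
        (auto simp: filterlim_ident)
    have "((\<lambda>T. (integral {0..T} (\<lambda>t. exp (- (s0 + ?k) * t) * h t) - exp (- ?k * T) * G T) / ?k)
        \<longlongrightarrow> (0 - 0 * 0) / ?k) at_top"
      by (intro tendsto_intros lim e0 Glim) auto
    then have "((\<lambda>T. (integral {0..T} (\<lambda>t. exp (- (s0 + ?k) * t) * h t) - exp (- ?k * T) * G T) / ?k)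
        \<longlongrightarrow> 0) at_top" by simp
    then show "((\<lambda>T. integral {0..T} (\<lambda>t. exp (- ?k * t) * G t)) \<longlongrightarrow> 0) at_top"
      by (rule Lim_transform_eventually)
        (use parts in \<open>auto intro!: eventually_at_top_linorderI[of 0]\<close>)
  qed
  have "((\<lambda>_. 0) has_vector_derivative ?g t) (at t)"
    by (rule has_vector_derivative_transform_within_open[OF Gd[OF t], of "{0<..}"])
      (use t Gz in auto)
  then have "?g t = 0"
    by (metis has_vector_derivative_const vector_derivative_unique_at)
  then show ?thesis by simp
qed

section \<open>Signals with a rational Laplace transform\<close>

text \<open>The signal and the real part of the exponential polynomial have the same transform at all large
real \<open>s\<close>, where the kernel \<open>exp (- s t)\<close> is real and commutes with taking real parts.\<close>

lemma signal_eq_exp_poly: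
  fixes g :: "real \<Rightarrow> real"
  assumes cont: "continuous_on {0<..} g"
    and lap: "\<And>s. \<sigma> < Re s \<Longrightarrow>
      ((\<lambda>t. exp (- s * of_real t) * of_real (g t)) has_integral F s) {0..}"
    and H: "is_exp_poly_transform c H" "\<And>s. \<sigma> < Re s \<Longrightarrow> c \<le> Re s \<Longrightarrow> F s = H s"
  obtains f G where "exp_poly c f G" "\<And>t. 0 < t \<Longrightarrow> g t = Re (f t)"
proof -
  obtain f G where f: "exp_poly c f G" and HG: "\<And>s. c \<le> Re s \<Longrightarrow> H s = G s"
    using H(1) unfolding is_exp_poly_transform_def by blast
  define h where "h t = g t - Re (f t)" for t
  define s0 where "s0 = max (\<sigma> + 1) c"
  have main: "(\<lambda>t. exp (- s * t) * h t) integrable_on {0..T} \<and>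
      ((\<lambda>T. integral {0..T} (\<lambda>t. exp (- s * t) * h t)) \<longlongrightarrow> 0) at_top" if s: "s0 \<le> s" for s T
  proof -
    let ?s = "complex_of_real s"
    let ?g = "\<lambda>t. exp (- ?s * of_real t) * of_real (g t)" and ?f = "\<lambda>t. exp (- ?s * of_real t) * f t"
    have ss: "\<sigma> < Re ?s" "c \<le> Re ?s" using s unfolding s0_def by auto
    have ig: "?g integrable_on {0..T}" for T
      by (rule has_integral_half_line_tendsto(1)[OF lap[OF ss(1)]])
    have "((\<lambda>T. integral {0..T} ?g) \<longlongrightarrow> G ?s) at_top"
      using has_integral_half_line_tendsto(2)[OF lap[OF ss(1)]] H(2)[OF ss] HG[OF ss(2)] by simp
    moreover have "?f integrable_on {0..T}" for T
      by (intro integrable_continuous_real continuous_intros exp_poly_continuous[OF f])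
    note if_ = this
    moreover have "((\<lambda>T. integral {0..T} ?f) \<longlongrightarrow> G ?s) at_top"
      by (rule exp_poly_laplace[OF f ss(2)])
    ultimately have "((\<lambda>T. integral {0..T} ?g - integral {0..T} ?f) \<longlongrightarrow> G ?s - G ?s) at_top"
      by (intro tendsto_diff)
    then have "((\<lambda>T. Re (integral {0..T} ?g - integral {0..T} ?f)) \<longlongrightarrow> Re 0) at_top"
      by (intro tendsto_Re) simp
    moreover have hi: "((\<lambda>t. exp (- s * t) * h t) has_integral Re (integral {0..T} ?g - integral {0..T} ?f)) {0..T}" for T
    proof -
      have "((\<lambda>t. Re (?g t - ?f t)) has_integral Re (integral {0..T} ?g - integral {0..T} ?f)) {0..T}"
        by (intro has_integral_Re has_integral_diff integrable_integral ig if_)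
      moreover have "Re (?g t - ?f t) = exp (- s * t) * h t" for t
      proof -
        have "exp (- ?s * of_real t) = complex_of_real (exp (- s * t))"
          by (metis exp_of_real of_real_minus of_real_mult)
        then show ?thesis by (simp add: h_def right_diff_distrib)
      qed
      ultimately show ?thesis by simp
    qed
    moreover have "integral {0..T} (\<lambda>t. exp (- s * t) * h t) = Re (integral {0..T} ?g - integral {0..T} ?f)" for T
      using hi by (rule integral_unique)
    ultimately show ?thesis using has_integral_integrable[OF hi] by simp
  qed
  have "h t = 0" if "0 < t" for t
  proof (rule laplace_unique[OF _ _ _ that])
    show "continuous_on {0<..} h"
      unfolding h_def by (intro continuous_intros cont exp_poly_continuous[OF f])
  qed (use main in blast)+
  then show ?thesis using that[OF f] by (simp add: h_def)
qed

text \<open>The signal is unconstrained for \<open>t \<le> 0\<close>, but derivatives at \<open>t > 0\<close> depend only on values near \<open>t\<close>,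
and exponential polynomials are closed under differentiation.\<close>

lemma iterated_deriv_exp_poly:
  assumes "exp_poly c f F" "\<And>t. 0 < t \<Longrightarrow> g t = Re (f t)"
  shows "\<exists>f' F'. exp_poly c f' F' \<and> (\<forall>t>0. (deriv ^^ k) g t = Re (f' t))"
    and "\<And>t. 0 < t \<Longrightarrow> (deriv ^^ k) g differentiable at t"
proof -
  have step: "\<exists>f' F'. exp_poly c f' F' \<and> (\<forall>t>0. (u has_real_derivative Re (f' t)) (at t))"
    if f: "exp_poly c f F" and u: "\<forall>t>0. u t = Re (f t)" for f F u
  proof -
    obtain f' F' where f': "exp_poly c f' F'" "\<And>t. (f has_vector_derivative f' t) (at t)"
      using exp_poly_deriv[OF f] by blast
    have "(u has_real_derivative Re (f' t)) (at t)" if t: "0 < t" for t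
    proof -
      have "((\<lambda>t. Re (f t)) has_vector_derivative Re (f' t)) (at t)"
        using bounded_linear.has_vector_derivative[OF bounded_linear_Re f'(2)] .
      then have "(u has_vector_derivative Re (f' t)) (at t)"
        by (rule has_vector_derivative_transform_within_open[of _ _ _ "{0<..}"]) (use t u in auto)
      then show ?thesis by (simp add: has_real_derivative_iff_has_vector_derivative)
    qed
    then show ?thesis using f'(1) by blast
  qed
  show *: "\<exists>f' F'. exp_poly c f' F' \<and> (\<forall>t>0. (deriv ^^ k) g t = Re (f' t))" for k
  proof (induction k)
    case 0 then show ?case using assms by auto
  next
    case (Suc k)
    then obtain f1 F1 where "exp_poly c f1 F1" "\<forall>t>0. (deriv ^^ k) g t = Re (f1 t)" by blast
    from step[OF this] show ?case by (auto dest: DERIV_imp_deriv)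
  qed
  fix t :: real assume "0 < t"
  obtain f1 F1 where "exp_poly c f1 F1" "\<forall>t>0. (deriv ^^ k) g t = Re (f1 t)" using * by blast
  from step[OF this] show "(deriv ^^ k) g differentiable at t"
    using \<open>0 < t\<close> unfolding real_differentiable_def by blast
qed

lemma iterated_deriv_diff:
  fixes g h :: "real \<Rightarrow> real"
  assumes g: "\<And>k t. 0 < t \<Longrightarrow> (deriv ^^ k) g differentiable at t"
    and h: "\<And>k t. 0 < t \<Longrightarrow> (deriv ^^ k) h differentiable at t"
    and t: "0 < t"
  shows "(deriv ^^ k) (\<lambda>t. g t - h t) t = (deriv ^^ k) g t - (deriv ^^ k) h t"
  using t
proof (induction k arbitrary: t)
  case (Suc k)
  have "((\<lambda>t. (deriv ^^ k) g t - (deriv ^^ k) h t) has_real_derivative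
      deriv ((deriv ^^ k) g) t - deriv ((deriv ^^ k) h) t) (at t)"
    using g[OF Suc.prems, of k] h[OF Suc.prems, of k]
    by (intro DERIV_diff) (simp_all add: DERIV_deriv_iff_real_differentiable)
  then have "((deriv ^^ k) (\<lambda>t. g t - h t) has_real_derivative
      deriv ((deriv ^^ k) g) t - deriv ((deriv ^^ k) h) t) (at t)"
    by (rule has_field_derivative_transform_within_open[of _ _ _ "{0<..}"]) (use Suc in auto)
  then show ?case by (auto dest: DERIV_imp_deriv)
qed simp

section \<open>Diagonalization of symmetric matrices\<close>

text \<open>A maximizer \<open>u\<close> of the Rayleigh quotient on the unit sphere of an invariant subspace is an eigenvector:
otherwise a small step from \<open>u\<close> along the residual \<open>f u - d u\<close> would increase the quotient.\<close>

lemma self_adjoint_eigenvector: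
  fixes f :: "'a::euclidean_space \<Rightarrow> 'a"
  assumes lin: "linear f" and sym: "\<And>x y. f x \<bullet> y = x \<bullet> f y"
    and S: "subspace S" "f ` S \<subseteq> S" "S \<noteq> {0}"
  shows "\<exists>u \<in> S. norm u = 1 \<and> (\<exists>d. f u = d *\<^sub>R u)"
proof -
  let ?K = "sphere 0 1 \<inter> S"
  interpret f: linear f by fact
  obtain z where z: "z \<in> S" "z \<noteq> 0" using S subspace_0 by blast
  have "(1 / norm z) *\<^sub>R z \<in> ?K" using z S(1) by (simp add: subspace_scale)
  moreover have "compact ?K"
    by (intro compact_Int_closed compact_sphere closed_subspace S)
  moreover have "continuous_on ?K (\<lambda>x. x \<bullet> f x)"
    by (intro continuous_intros linear_continuous_on linear_linear[THEN iffD1] lin)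
      (use lin linear_conv_bounded_linear in blast)
  ultimately obtain u where u: "u \<in> ?K" and max: "\<And>x. x \<in> ?K \<Longrightarrow> x \<bullet> f x \<le> u \<bullet> f u"
    using continuous_attains_sup[of ?K "\<lambda>x. x \<bullet> f x"] by blast
  define d where "d = u \<bullet> f u"
  have uS: "u \<in> S" and u1: "norm u = 1" using u by auto
  have quad: "x \<bullet> f x \<le> d * (x \<bullet> x)" if x: "x \<in> S" for x
  proof (cases "x = 0")
    case True then show ?thesis by (simp add: f.zero)
  next
    case False
    let ?y = "(1 / norm x) *\<^sub>R x"
    have "?y \<in> ?K" using x False S(1) by (simp add: subspace_scale)
    then have "?y \<bullet> f ?y \<le> d" using max d_def by blast
    then have "(x \<bullet> f x) / (norm x)\<^sup>2 \<le> d"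
      by (simp add: f.scale power2_eq_square)
    then show ?thesis using False by (simp add: field_simps dot_square_norm)
  qed
  define w where "w = f u - d *\<^sub>R u"
  have wS: "w \<in> S" unfolding w_def using uS S by (auto intro: subspace_diff subspace_scale)
  have "w \<bullet> w = 0"
  proof (rule ccontr)
    assume ne: "w \<bullet> w \<noteq> 0"
    then have pos: "0 < w \<bullet> w" using inner_ge_zero[of w] by linarith
    have key: "2 * t * (w \<bullet> w) \<le> t\<^sup>2 * (d * (w \<bullet> w) - w \<bullet> f w)" for t
    proof -
      have "u + t *\<^sub>R w \<in> S" using uS wS S(1) by (simp add: subspace_add subspace_scale)
      from quad[OF this]
      have "u \<bullet> f u + 2 * t * (w \<bullet> f u) + t\<^sup>2 * (w \<bullet> f w) \<le> d * (u \<bullet> u) + 2 * t * (d * (u \<bullet> w)) + t\<^sup>2 * (d * (w \<bullet> w))"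
        using sym[of u w] by (simp add: f.add f.scale inner_simps inner_commute power2_eq_square algebra_simps)
      moreover have "u \<bullet> f u = d * (u \<bullet> u)" using u1 by (simp add: d_def dot_square_norm)
      moreover have "w \<bullet> f u = w \<bullet> w + d * (u \<bullet> w)"
        by (simp add: w_def inner_simps inner_commute algebra_simps)
      ultimately show ?thesis by (simp add: algebra_simps)
    qed
    define A where "A = \<bar>d * (w \<bullet> w) - w \<bullet> f w\<bar> + 1"
    have A: "0 < A" "d * (w \<bullet> w) - w \<bullet> f w \<le> A" unfolding A_def by linarith+
    \<comment> \<open>For this step length the gain \<open>2 t (w \<bullet> w)\<close> of first order exceeds the term of second order.\<close>
    define t where "t = (w \<bullet> w) / A"
    have t: "0 < t" using pos A by (simp add: t_def)
    have "2 * t * (w \<bullet> w) \<le> t\<^sup>2 * A"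
      using key[of t] mult_left_mono[OF A(2), of "t\<^sup>2"] by simp
    also have "\<dots> = t * (w \<bullet> w)" using A(1) by (simp add: t_def power2_eq_square)
    finally show False using t pos by (simp add: mult_pos_pos not_le[symmetric])
  qed
  then have "f u = d *\<^sub>R u" by (simp add: w_def)
  then show ?thesis using uS u1 by blast
qed

text \<open>Spectral theorem. An orthonormal set of eigenvectors of maximal size spans the space, since its orthogonal complement is
invariant and would otherwise contain a further eigenvector. The rows of \<open>Q\<close> are the eigenvectors.\<close>

lemma symmetric_matrix_diagonalizable:
  fixes L :: "real^'v^'v"
  assumes sym: "transpose L = L"
  obtains Q :: "real^'v^'v" and d :: "'v \<Rightarrow> real"
  where "orthogonal_matrix Q" "\<And>m. L *v (Q $ m) = d m *\<^sub>R (Q $ m)"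
proof -
  let ?f = "(*v) L"
  have adj: "(L *v x) \<bullet> y = x \<bullet> (L *v y)" for x y
    using dot_lmul_matrix[of x L y] sym by (metis vector_transpose_matrix)
  define ok where "ok B \<longleftrightarrow> pairwise orthogonal B \<and> (\<forall>b\<in>B. norm b = 1 \<and> (\<exists>d. L *v b = d *\<^sub>R b))"
    for B :: "(real^'v) set"
  have ok_ind: "independent B \<and> finite B \<and> card B \<le> CARD('v)" if "ok B" for B
  proof -
    have "0 \<notin> B" using that unfolding ok_def by force
    then have i: "independent B"
      using that unfolding ok_def by (intro pairwise_orthogonal_independent) auto
    then show ?thesis using independent_bound[OF i] by simp
  qed
  have "ok {}" by (simp add: ok_def)
  moreover have "\<forall>C. ok C \<longrightarrow> card C < Suc CARD('v)"
    using ok_ind by (simp add: less_Suc_eq_le)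
  ultimately have "\<exists>B. ok B \<and> (\<forall>C. ok C \<longrightarrow> card C \<le> card B)"
    by (rule Lattices_Big.ex_has_greatest_nat)
  then obtain B where B: "ok B" and Bmax: "\<And>C. ok C \<Longrightarrow> card C \<le> card B"
    by blast
  have cB: "card B = CARD('v)"
  proof (rule ccontr)
    assume "card B \<noteq> CARD('v)"
    then have lt: "card B < CARD('v)" using ok_ind[OF B] by linarith
    define S where "S = {x. \<forall>b\<in>B. orthogonal b x}"
    have S: "subspace S" unfolding S_def by (rule subspace_orthogonal_to_vectors)
    have "?f ` S \<subseteq> S"
    proof
      fix y assume "y \<in> ?f ` S"
      then obtain x where x: "x \<in> S" "y = L *v x" by blast
      have "b \<bullet> y = 0" if b: "b \<in> B" for b
      proof -
        obtain c where "L *v b = c *\<^sub>R b" using B b unfolding ok_def by blast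
        then show ?thesis using adj[of b x] x b by (simp add: S_def orthogonal_def)
      qed
      then show "y \<in> S" by (simp add: S_def orthogonal_def)
    qed
    moreover have "S \<noteq> {0}"
    proof
      assume S0: "S = {0}"
      have "span B = UNIV"
      proof (rule ccontr)
        assume "span B \<noteq> UNIV"
        then obtain a where "a \<noteq> 0" "\<forall>x \<in> span B. a \<bullet> x = 0"
          using span_not_UNIV_orthogonal by blast
        then have "a \<in> S" by (simp add: S_def orthogonal_def span_base inner_commute)
        then show False using S0 \<open>a \<noteq> 0\<close> by blast
      qed
      then have "dim B = CARD('v)" by (metis dim_UNIV dim_span DIM_cart DIM_real mult.right_neutral)
      then show False using lt ok_ind[OF B] dim_le_card'[of B] by simp
    qed
    ultimately obtain u c where u: "u \<in> S" "norm u = 1" "L *v u = c *\<^sub>R u"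
      using self_adjoint_eigenvector[of ?f S] adj S matrix_vector_mul_linear by blast
    have "u \<notin> B" using u unfolding S_def orthogonal_def by (metis (mono_tags, lifting) inner_eq_zero_iff mem_Collect_eq norm_zero zero_neq_one)
    moreover have "ok (insert u B)"
      using B u unfolding ok_def pairwise_insert S_def
      by (auto simp: orthogonal_commute)
    ultimately show False using Bmax[of "insert u B"] ok_ind[OF B] by simp
  qed
  obtain q where q: "bij_betw q (UNIV :: 'v set) B"
    using finite_same_card_bij[of "UNIV :: 'v set" B] cB ok_ind[OF B] by auto
  define Q where "Q = (\<chi> m. q m)"
  have qB: "q m \<in> B" for m using q bij_betwE by blast
  have "orthogonal_matrix Q"
    unfolding orthogonal_matrix_orthonormal_rows
  proof (intro conjI allI impI)
    fix i j :: 'v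
    show "norm (row i Q) = 1" using qB[of i] B by (simp add: Q_def row_def ok_def vec_lambda_eta)
    assume "i \<noteq> j"
    then have "q i \<noteq> q j" using q by (metis UNIV_I bij_betw_inv_into_left)
    then show "orthogonal (row i Q) (row j Q)"
      using qB[of i] qB[of j] B by (simp add: Q_def row_def ok_def vec_lambda_eta pairwise_def)
  qed
  moreover have "\<exists>d. \<forall>m. L *v (Q $ m) = d m *\<^sub>R (Q $ m)"
    using qB B unfolding ok_def Q_def by (intro choice) simp
  ultimately show ?thesis using that by blast
qed

section \<open>The symmetric graph Laplacian\<close>

text \<open>Each edge is counted in both directions, hence the factor 2.\<close>

lemma laplacian_quadratic_form:
  fixes W :: "real^'v^'v"
  assumes L: "L = graph_laplacian W" and sym: "L = transpose L"
  shows "2 * (x \<bullet> (L *v x)) = (\<Sum>i\<in>UNIV. \<Sum>j\<in>UNIV. if i = j then 0 else W $ i $ j * (x $ i - x $ j)\<^sup>2)"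
proof -
  have symW: "W $ i $ j = W $ j $ i" if "i \<noteq> j" for i j
  proof -
    have "L $ i $ j = L $ j $ i" using sym by (metis transpose_def vec_lambda_beta)
    then show ?thesis using that by (simp add: L graph_laplacian_def)
  qed
  define w where "w i j = (if i = j then 0 else W $ i $ j)" for i j
  have w: "w i j = w j i" for i j using symW by (simp add: w_def)
  have Lx: "(L *v x) $ i = (\<Sum>j\<in>UNIV. w i j * (x $ i - x $ j))" for i
  proof -
    have "(L *v x) $ i = L $ i $ i * x $ i + (\<Sum>j\<in>UNIV - {i}. L $ i $ j * x $ j)"
      by (simp add: matrix_vector_mult_def sum.remove[of UNIV i])
    also have "\<dots> = (\<Sum>j\<in>UNIV - {i}. W $ i $ j * x $ i) + (\<Sum>j\<in>UNIV - {i}. - (W $ i $ j * x $ j))"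
      by (auto simp: L graph_laplacian_def sum_distrib_right intro!: sum.cong)
    also have "\<dots> = (\<Sum>j\<in>UNIV - {i}. W $ i $ j * (x $ i - x $ j))"
      by (simp add: sum.distrib[symmetric] algebra_simps)
    also have "\<dots> = (\<Sum>j\<in>UNIV - {i}. w i j * (x $ i - x $ j))"
      by (intro sum.cong) (auto simp: w_def)
    also have "\<dots> = (\<Sum>j\<in>UNIV. w i j * (x $ i - x $ j))"
      by (subst sum.remove[of UNIV i]) (auto simp: w_def)
    finally show ?thesis .
  qed
  have 1: "x \<bullet> (L *v x) = (\<Sum>i\<in>UNIV. \<Sum>j\<in>UNIV. w i j * (x $ i - x $ j) * x $ i)"
    by (simp add: inner_vec_def Lx sum_distrib_right sum_distrib_left mult_ac)
  also have "\<dots> = (\<Sum>i\<in>UNIV. \<Sum>j\<in>UNIV. w j i * (x $ j - x $ i) * x $ j)"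
    by (rule sum.swap)
  also have "\<dots> = (\<Sum>i\<in>UNIV. \<Sum>j\<in>UNIV. w i j * (x $ j - x $ i) * x $ j)"
    using w by (intro sum.cong) auto
  finally have 2: "x \<bullet> (L *v x) = \<dots>" .
  have "2 * (x \<bullet> (L *v x)) = (\<Sum>i\<in>UNIV. \<Sum>j\<in>UNIV. w i j * (x $ i - x $ j) * x $ i + w i j * (x $ j - x $ i) * x $ j)"
    using 1 2 by (simp add: sum.distrib)
  also have "\<dots> = (\<Sum>i\<in>UNIV. \<Sum>j\<in>UNIV. if i = j then 0 else W $ i $ j * (x $ i - x $ j)\<^sup>2)"
    by (intro sum.cong) (auto simp: w_def power2_eq_square algebra_simps)
  finally show ?thesis .
qed

lemma laplacian_psd:
  fixes W :: "real^'v^'v"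
  assumes "weighted_graph E W" "L = graph_laplacian W" "L = transpose L"
  shows "0 \<le> x \<bullet> (L *v x)"
proof -
  have "0 \<le> 2 * (x \<bullet> (L *v x))"
    unfolding laplacian_quadratic_form[OF assms(2,3)]
    using assms(1) by (intro sum_nonneg) (auto simp: weighted_graph_def)
  then show ?thesis by simp
qed

text \<open>All terms of the quadratic form vanish, so a kernel vector is constant along edges and hence
along the paths from the root of the spanning tree.\<close>

lemma laplacian_kernel_constant:
  fixes W :: "real^'v^'v"
  assumes G: "weighted_graph E W" and L: "L = graph_laplacian W" "L = transpose L"
    and tree: "contains_spanning_tree E" and x: "L *v x = 0"
  shows "x $ i = x $ j"
proof -
  have "(\<Sum>i\<in>UNIV. \<Sum>j\<in>UNIV. if i = j then 0 else W $ i $ j * (x $ i - x $ j)\<^sup>2) = 0"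
    using laplacian_quadratic_form[OF L, of x] x by simp
  then have z: "(if i = j then 0 else W $ i $ j * (x $ i - x $ j)\<^sup>2) = 0" for i j
    using G by (subst (asm) sum_nonneg_eq_0_iff; (intro sum_nonneg)?)
      (auto simp: weighted_graph_def sum_nonneg_eq_0_iff)
  have edge: "x $ a = x $ b" if "(a, b) \<in> E" for a b
    using z[of b a] G that unfolding weighted_graph_def by (force split: if_splits)
  have path: "x $ a = x $ b" if "(a, b) \<in> E\<^sup>*" for a b
    using that by (induction rule: rtrancl_induct) (auto dest: edge)
  obtain r where "\<forall>j. j \<noteq> r \<longrightarrow> (r, j) \<in> E\<^sup>*" using tree unfolding contains_spanning_tree_def by blast
  then have "x $ r = x $ k" for k using path by (cases "k = r") auto
  then show ?thesis by metis
qed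

section \<open>Functions of a diagonalized matrix\<close>

text \<open>For \<open>L = Q\<^sup>T diag(d) Q\<close> this is the matrix \<open>f(L) = Q\<^sup>T diag(f(d)) Q\<close>, where \<open>\<phi> m = f (d m)\<close> lists the values
of \<open>f\<close> at the eigenvalues.\<close>

definition spectral_matrix :: "real^'v^'v \<Rightarrow> ('v \<Rightarrow> complex) \<Rightarrow> complex^'v^'v" where
  "spectral_matrix Q \<phi> = (\<chi> i j. \<Sum>m\<in>UNIV. of_real (Q $ m $ i) * \<phi> m * of_real (Q $ m $ j))"

lemma orthogonal_matrix_sums:
  fixes Q :: "real^'v^'v"
  assumes "orthogonal_matrix Q"
  shows "(\<Sum>m\<in>UNIV. Q $ m $ i * Q $ m $ j) = (if i = j then 1 else 0)"
    and "(\<Sum>i\<in>UNIV. Q $ m $ i * Q $ k $ i) = (if m = k then 1 else 0)"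
proof -
  have "(transpose Q ** Q) $ i $ j = mat 1 $ i $ j" "(Q ** transpose Q) $ m $ k = mat 1 $ m $ k"
    using assms unfolding orthogonal_matrix_def by auto
  then show "(\<Sum>m\<in>UNIV. Q $ m $ i * Q $ m $ j) = (if i = j then 1 else 0)"
    and "(\<Sum>i\<in>UNIV. Q $ m $ i * Q $ k $ i) = (if m = k then 1 else 0)"
    by (simp_all add: matrix_matrix_mult_def transpose_def mat_def)
qed

lemma spectral_matrix_mult:
  assumes "orthogonal_matrix Q"
  shows "spectral_matrix Q \<phi> ** spectral_matrix Q \<psi> = spectral_matrix Q (\<lambda>m. \<phi> m * \<psi> m)"
proof -
  have "(\<Sum>l\<in>UNIV. (\<Sum>m\<in>UNIV. of_real (Q$m$i) * \<phi> m * of_real (Q$m$l))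
        * (\<Sum>k\<in>UNIV. of_real (Q$k$l) * \<psi> k * of_real (Q$k$j)))
      = (\<Sum>m\<in>UNIV. of_real (Q$m$i) * (\<phi> m * \<psi> m) * of_real (Q$m$j))" for i j
  proof -
    have "(\<Sum>l\<in>UNIV. (\<Sum>m\<in>UNIV. of_real (Q$m$i) * \<phi> m * of_real (Q$m$l))
        * (\<Sum>k\<in>UNIV. of_real (Q$k$l) * \<psi> k * of_real (Q$k$j)))
      = (\<Sum>l\<in>UNIV. \<Sum>m\<in>UNIV. \<Sum>k\<in>UNIV. (of_real (Q$m$i) * \<phi> m * \<psi> k * of_real (Q$k$j)) * of_real (Q$m$l * Q$k$l))"
      by (simp add: sum_product mult_ac)
    also have "\<dots> = (\<Sum>m\<in>UNIV. \<Sum>l\<in>UNIV. \<Sum>k\<in>UNIV. (of_real (Q$m$i) * \<phi> m * \<psi> k * of_real (Q$k$j)) * of_real (Q$m$l * Q$k$l))"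
      by (rule sum.swap)
    also have "\<dots> = (\<Sum>m\<in>UNIV. \<Sum>k\<in>UNIV. \<Sum>l\<in>UNIV. (of_real (Q$m$i) * \<phi> m * \<psi> k * of_real (Q$k$j)) * of_real (Q$m$l * Q$k$l))"
      by (intro sum.cong refl sum.swap)
    also have "\<dots> = (\<Sum>m\<in>UNIV. \<Sum>k\<in>UNIV. (of_real (Q$m$i) * \<phi> m * \<psi> k * of_real (Q$k$j)) * of_real (if m = k then 1 else 0))"
      by (simp only: sum_distrib_left[symmetric] of_real_sum[symmetric] orthogonal_matrix_sums(2)[OF assms])
    also have "\<dots> = (\<Sum>m\<in>UNIV. \<Sum>k\<in>UNIV. if k = m then of_real (Q$m$i) * \<phi> m * \<psi> k * of_real (Q$k$j) else 0)"
      by (intro sum.cong) auto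
    also have "\<dots> = (\<Sum>m\<in>UNIV. of_real (Q$m$i) * (\<phi> m * \<psi> m) * of_real (Q$m$j))"
      by (simp add: mult.assoc)
    finally show ?thesis .
  qed
  then show ?thesis
    by (simp add: spectral_matrix_def matrix_matrix_mult_def)
qed

lemma spectral_matrix_const:
  assumes "orthogonal_matrix Q"
  shows "spectral_matrix Q (\<lambda>_. c) = mat c"
proof -
  have "(\<Sum>m\<in>UNIV. of_real (Q$m$i) * c * of_real (Q$m$j)) = c * of_real (\<Sum>m\<in>UNIV. Q$m$i * Q$m$j)" for i j
    by (simp add: sum_distrib_left mult_ac)
  then show ?thesis
    by (simp add: spectral_matrix_def mat_def orthogonal_matrix_sums(1)[OF assms] vec_eq_iff)
qed

lemma spectral_matrix_add:
  "spectral_matrix Q \<phi> + spectral_matrix Q \<psi> = spectral_matrix Q (\<lambda>m. \<phi> m + \<psi> m)"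
  by (simp add: spectral_matrix_def vec_eq_iff sum.distrib[symmetric] algebra_simps)

lemma spectral_matrix_pow:
  assumes "orthogonal_matrix Q"
  shows "matrix_pow (spectral_matrix Q \<phi>) k = spectral_matrix Q (\<lambda>m. \<phi> m ^ k)"
  by (induction k)
    (simp_all add: matrix_pow_def spectral_matrix_const[OF assms] spectral_matrix_mult[OF assms])

lemma spectral_matrix_eigen:
  fixes L Q :: "real^'v^'v"
  assumes Q: "orthogonal_matrix Q" and eig: "\<And>m. L *v (Q $ m) = d m *\<^sub>R (Q $ m)"
  shows "spectral_matrix Q (\<lambda>m. of_real (d m)) = map_matrix of_real L"
proof -
  have "(\<Sum>m\<in>UNIV. Q$m$i * d m * Q$m$j) = L $ i $ j" for i j
  proof -
    have e: "(\<Sum>k\<in>UNIV. L $ i $ k * Q $ m $ k) = d m * Q $ m $ i" for m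
      using arg_cong[OF eig[of m], of "\<lambda>v. v $ i"] by (simp add: matrix_vector_mult_def)
    have "(\<Sum>m\<in>UNIV. Q$m$i * d m * Q$m$j) = (\<Sum>m\<in>UNIV. (\<Sum>k\<in>UNIV. L $ i $ k * Q $ m $ k) * Q$m$j)"
      by (simp add: e mult_ac)
    also have "\<dots> = (\<Sum>m\<in>UNIV. \<Sum>k\<in>UNIV. L $ i $ k * (Q $ m $ k * Q$m$j))"
      by (simp add: sum_distrib_right mult.assoc)
    also have "\<dots> = (\<Sum>k\<in>UNIV. L $ i $ k * (\<Sum>m\<in>UNIV. Q $ m $ k * Q$m$j))"
      by (subst sum.swap) (simp add: sum_distrib_left)
    also have "\<dots> = (\<Sum>k\<in>UNIV. if k = j then L $ i $ k else 0)"
      unfolding orthogonal_matrix_sums(1)[OF Q] by (intro sum.cong) auto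
    finally show ?thesis by simp
  qed
  then have "(\<Sum>m\<in>UNIV. of_real (Q$m$i) * of_real (d m) * of_real (Q$m$j)) = complex_of_real (L $ i $ j)" for i j
    by (metis (mono_tags, lifting) of_real_mult of_real_sum sum.cong)
  then show ?thesis
    by (simp add: spectral_matrix_def vec_eq_iff)
qed

lemma norm_cvec_sq: "(norm (y :: complex^'n))\<^sup>2 = (\<Sum>i\<in>UNIV. (cmod (y $ i))\<^sup>2)"
  by (simp add: norm_vec_def L2_set_def sum_nonneg)

text \<open>A real orthogonal matrix acts on the real and on the imaginary part separately.\<close>

lemma norm_orthogonal_cvec:
  fixes R :: "real^'v^'v" and y :: "complex^'v"
  assumes "orthogonal_matrix R"
  shows "norm (\<chi> m. \<Sum>j\<in>UNIV. of_real (R $ m $ j) * y $ j) = norm y"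
proof -
  have norm_R: "norm (R *v x) = norm x" for x
    using assms orthogonal_transformation_matrix[of "(*v) R"]
    by (simp add: matrix_of_matrix_vector_mul orthogonal_transformation)
  have sq: "(\<Sum>m\<in>UNIV. (\<Sum>j\<in>UNIV. R $ m $ j * x j)\<^sup>2) = (\<Sum>j\<in>UNIV. (x j)\<^sup>2)" for x
    using arg_cong[OF norm_R[of "\<chi> j. x j"], of "\<lambda>r. r\<^sup>2"]
    by (simp add: norm_vec_def L2_set_def sum_nonneg matrix_vector_mult_def)
  have "(norm (\<chi> m. \<Sum>j\<in>UNIV. of_real (R $ m $ j) * y $ j))\<^sup>2 = (norm y)\<^sup>2"
    unfolding norm_cvec_sq
    by (simp add: cmod_power2 sum.distrib sq)
  then show ?thesis by simp
qed

lemma norm_spectral_matrix: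
  fixes y :: "complex^'v"
  assumes Q: "orthogonal_matrix Q" and B: "\<And>m. cmod (\<phi> m) \<le> B"
  shows "norm (spectral_matrix Q \<phi> *v y) \<le> B * norm y"
proof -
  define z where "z = (\<chi> m. \<Sum>j\<in>UNIV. of_real (Q $ m $ j) * y $ j)"
  define w where "w = (\<chi> m. \<phi> m * z $ m)"
  have B0: "0 \<le> B" using B norm_ge_zero order_trans by blast
  have "spectral_matrix Q \<phi> *v y = (\<chi> i. \<Sum>m\<in>UNIV. of_real (transpose Q $ i $ m) * w $ m)"
  proof -
    have "(\<Sum>j\<in>UNIV. (\<Sum>m\<in>UNIV. of_real (Q$m$i) * \<phi> m * of_real (Q$m$j)) * y $ j)
        = (\<Sum>m\<in>UNIV. of_real (Q$m$i) * (\<phi> m * (\<Sum>j\<in>UNIV. of_real (Q$m$j) * y $ j)))" for i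
      by (simp add: sum_distrib_left sum_distrib_right mult.assoc) (rule sum.swap)
    then show ?thesis
      by (simp add: spectral_matrix_def matrix_vector_mult_def w_def z_def transpose_def)
  qed
  then have "norm (spectral_matrix Q \<phi> *v y) = norm w"
    using norm_orthogonal_cvec[of "transpose Q" w] Q by (simp add: orthogonal_matrix_transpose)
  also have "\<dots> \<le> B * norm z"
  proof (rule power2_le_imp_le)
    have "(norm w)\<^sup>2 \<le> (\<Sum>m\<in>UNIV. (B * cmod (z $ m))\<^sup>2)"
      unfolding norm_cvec_sq w_def using B B0
      by (intro sum_mono power_mono) (auto simp: norm_mult intro: mult_right_mono)
    also have "\<dots> = (B * norm z)\<^sup>2"
      by (simp add: power_mult_distrib norm_cvec_sq sum_distrib_left)
    finally show "(norm w)\<^sup>2 \<le> (B * norm z)\<^sup>2" .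
  qed (use B0 in auto)
  also have "norm z = norm y" unfolding z_def by (rule norm_orthogonal_cvec[OF Q])
  finally show ?thesis .
qed

section \<open>The modal gains\<close>

text \<open>Weighted inequality of the arithmetic and geometric means. The proof scales the maximum of the
left side to \<open>A = B = 1\<close> and multiplies powers of \<open>A \<le> exp (A - 1)\<close> and \<open>B \<le> exp (B - 1)\<close>.\<close>

lemma power_product_le:
  fixes a b :: real
  assumes "0 \<le> a" "0 \<le> b" "k \<le> n"
  shows "a ^ k * b ^ (n - k) \<le> (real k ^ k / real n ^ n * real (n - k) ^ (n - k)) * (a + b) ^ n"
proof -
  consider "k = 0" | "k = n" | "0 < k" "k < n" using assms(3) by linarith
  then show ?thesis
  proof cases
    case 1 then show ?thesis using assms by (auto intro: power_mono)
  next
    case 2 then show ?thesis using assms by (auto intro: power_mono)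
  next
    case 3
    show ?thesis
    proof (cases "a + b = 0")
      case True
      then have "a = 0" using assms by linarith
      then show ?thesis using 3 True by (simp add: power_0_left)
    next
      case False
      define A where "A = real n * a / (real k * (a + b))"
      define B where "B = real n * b / (real (n - k) * (a + b))"
      have AB0: "0 \<le> A" "0 \<le> B" using assms by (auto simp: A_def B_def)
      have nk: "real (n - k) = real n - real k" using 3 by simp
      \<comment> \<open>The weighted arithmetic mean of \<open>A\<close> and \<open>B\<close> equals 1.\<close>
      have sum0: "real k * (A - 1) + real (n - k) * (B - 1) = 0"
      proof -
        have "real k * A = real n * a / (a + b)" "real (n - k) * B = real n * b / (a + b)"
          using 3 by (auto simp: A_def B_def)
        then have "real k * A + real (n - k) * B = real n * (a + b) / (a + b)"
          by (simp only: distrib_left add_divide_distrib)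
        also have "\<dots> = real n" using False by simp
        finally show ?thesis by (simp add: algebra_simps nk)
      qed
      have "A \<le> exp (A - 1)" "B \<le> exp (B - 1)" using exp_ge_add_one_self[of "A - 1"] exp_ge_add_one_self[of "B - 1"] by auto
      then have "A ^ k * B ^ (n - k) \<le> exp (A - 1) ^ k * exp (B - 1) ^ (n - k)"
        using AB0 by (intro mult_mono power_mono) auto
      also have "\<dots> = exp (real k * (A - 1) + real (n - k) * (B - 1))"
        by (simp only: exp_add exp_of_nat_mult)
      also have "\<dots> = 1" using sum0 by simp
      finally have le1: "A ^ k * B ^ (n - k) \<le> 1" .
      define c where "c = real k ^ k * real (n - k) ^ (n - k) * (a + b) ^ n"
      have pos: "0 < c" using assms False 3 by (auto simp: c_def intro!: mult_pos_pos)
      have split: "z ^ n = z ^ k * z ^ (n - k)" for z :: real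
        using 3 by (simp add: power_add[symmetric])
      have "A ^ k * B ^ (n - k) = real n ^ n * (a ^ k * b ^ (n - k)) / c"
        unfolding A_def B_def c_def split[of "real n"] split[of "a + b"]
        by (simp add: power_divide power_mult_distrib mult_ac)
      then have "real n ^ n * (a ^ k * b ^ (n - k)) \<le> c" using le1 pos by (metis divide_le_eq_1_pos)
      then show ?thesis using 3 by (simp add: c_def field_simps)
    qed
  qed
qed

text \<open>The restriction of \<open>s\<^sup>k L\<^sup>n\<^sup>-\<^sup>k (s + L)\<^sup>-\<^sup>n\<close> to an eigenspace of \<open>L\<close> with eigenvalue \<open>x\<close>. For \<open>x = 0\<close>
the singularity at \<open>s = 0\<close> is removable; the explicit value there makes the function proper and
stable.\<close>

definition modal_gain :: "real \<Rightarrow> nat \<Rightarrow> nat \<Rightarrow> complex \<Rightarrow> complex" where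
  "modal_gain x n k s = (if x = 0 then (if k = n then 1 else 0)
     else (s / (s + of_real x)) ^ k * (of_real x / (s + of_real x)) ^ (n - k))"

lemma proper_stable_modal_gain:
  assumes "0 \<le> x" shows "proper_stable (modal_gain x n k)"
proof (cases "x = 0")
  case True then show ?thesis unfolding modal_gain_def by (auto simp: proper_stable_const)
next
  case False
  then have x: "0 < Re (of_real x)" using assms by simp
  have "proper_stable (\<lambda>s. (s / (s + of_real x)) ^ k * (of_real x * (1 / (s + of_real x))) ^ (n - k))"
    by (intro proper_stable_mult proper_stable_power proper_stable_highpass proper_stable_lowpass
        proper_stable_const x)
  then show ?thesis using False by (simp add: modal_gain_def[abs_def])
qed

lemma modal_gain_mult_power:
  assumes "0 \<le> x" "0 < Re s" "k \<le> n"
  shows "modal_gain x n k s * (s + of_real x) ^ n = s ^ k * of_real x ^ (n - k)"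
proof -
  have ne: "s + of_real x \<noteq> 0" using assms by (auto simp: complex_eq_iff)
  have split: "z ^ n = z ^ k * z ^ (n - k)" for z :: complex
    using assms(3) by (simp add: power_add[symmetric])
  show ?thesis
  proof (cases "x = 0")
    case True then show ?thesis using assms(3) by (auto simp: modal_gain_def)
  next
    case False
    then show ?thesis using ne by (simp add: modal_gain_def split power_divide)
  qed
qed

text \<open>For \<open>Re s > 0\<close> and \<open>x \<ge> 0\<close> the angle between \<open>s\<close> and \<open>x\<close> is acute, so
\<open>\<bar>s\<bar>\<^sup>2 + x\<^sup>2 \<le> \<bar>s + x\<bar>\<^sup>2\<close>, and the modulus is controlled by \<open>power_product_le\<close>.\<close>

lemma cmod_modal_gain_le:
  assumes x: "0 \<le> x" and s: "0 < Re s" and k: "k \<le> n" and n: "1 \<le> n"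
  shows "cmod (modal_gain x n k s) \<le> sqrt (real k ^ k / real n ^ n * real (n - k) ^ (n - k))"
proof -
  let ?c = "real k ^ k / real n ^ n * real (n - k) ^ (n - k)"
  let ?r = "cmod (s + of_real x)"
  have ne: "s + of_real x \<noteq> 0" using assms by (auto simp: complex_eq_iff)
  then have r: "0 < ?r" by simp
  have pyth: "(cmod s)\<^sup>2 + x\<^sup>2 \<le> ?r\<^sup>2"
    unfolding cmod_power2 using x s by (simp add: power2_eq_square algebra_simps)
  have "(cmod (modal_gain x n k s) * ?r ^ n)\<^sup>2 = ((cmod s)\<^sup>2) ^ k * (x\<^sup>2) ^ (n - k)"
    using arg_cong[OF modal_gain_mult_power[OF x s k], of cmod] x
    by (simp add: norm_mult norm_power power_mult_distrib power_mult[symmetric] mult.commute)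
  also have "\<dots> \<le> ?c * ((cmod s)\<^sup>2 + x\<^sup>2) ^ n"
    by (rule power_product_le) (use k in auto)
  also have "\<dots> \<le> ?c * (?r\<^sup>2) ^ n"
    using pyth by (intro mult_left_mono power_mono) auto
  finally have "(cmod (modal_gain x n k s))\<^sup>2 * (?r\<^sup>2) ^ n \<le> ?c * (?r\<^sup>2) ^ n"
    by (simp add: power_mult_distrib power_mult[symmetric] mult.commute)
  then have "(cmod (modal_gain x n k s))\<^sup>2 \<le> ?c"
    by (rule mult_right_le_imp_le) (use r in simp)
  then show ?thesis by (rule real_le_rsqrt)
qed

section \<open>The H-infinity norm and the inverse of a stable transfer matrix\<close>

lemma norm_matrix_vector_le_sum:
  fixes A :: "complex^'n^'m"
  shows "norm (A *v y) \<le> (\<Sum>i\<in>UNIV. \<Sum>j\<in>UNIV. cmod (A $ i $ j)) * norm y"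
proof -
  have "norm (A *v y) \<le> (\<Sum>i\<in>UNIV. cmod ((A *v y) $ i))"
    unfolding norm_vec_def by (rule L2_set_le_sum) auto
  also have "\<dots> \<le> (\<Sum>i\<in>UNIV. \<Sum>j\<in>UNIV. cmod (A $ i $ j) * norm y)"
  proof (rule sum_mono)
    fix i
    have "cmod ((A *v y) $ i) \<le> (\<Sum>j\<in>UNIV. cmod (A $ i $ j * y $ j))"
      unfolding matrix_vector_mult_def by (simp add: norm_sum)
    also have "\<dots> \<le> (\<Sum>j\<in>UNIV. cmod (A $ i $ j) * norm y)"
      by (intro sum_mono) (simp add: norm_mult mult_left_mono Finite_Cartesian_Product.norm_nth_le)
    finally show "cmod ((A *v y) $ i) \<le> (\<Sum>j\<in>UNIV. cmod (A $ i $ j) * norm y)" .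
  qed
  finally show ?thesis by (simp add: sum_distrib_right)
qed

text \<open>The entries are bounded, so the supremum that defines the norm is a genuine upper bound.\<close>

lemma norm_le_Hinf_norm:
  fixes F :: "complex \<Rightarrow> complex^'n^'m"
  assumes F: "F \<in> RH_inf_mat" and s: "0 < Re s"
  shows "norm (F s *v y) \<le> Hinf_norm F * norm y"
proof -
  have "\<forall>i j. \<exists>B. \<forall>s. 0 \<le> Re s \<longrightarrow> cmod (F s $ i $ j) \<le> B"
    using F by (auto simp: RH_inf_mat_def intro!: proper_stable_bounded RH_inf_imp_proper_stable)
  then obtain B where B: "\<And>i j s. 0 \<le> Re s \<Longrightarrow> cmod (F s $ i $ j) \<le> B i j" by metis
  have lin: "bounded_linear ((*v) (F s))" for s by (rule matrix_vector_mul_bounded_linear)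
  have "onorm ((*v) (F z)) \<le> (\<Sum>i\<in>UNIV. \<Sum>j\<in>UNIV. B i j)" if "0 < Re z" for z
  proof (rule onorm_le)
    fix y :: "complex^'n"
    have "(\<Sum>i\<in>UNIV. \<Sum>j\<in>UNIV. cmod (F z $ i $ j)) * norm y \<le> (\<Sum>i\<in>UNIV. \<Sum>j\<in>UNIV. B i j) * norm y"
      using B that by (intro mult_right_mono sum_mono) auto
    then show "norm (F z *v y) \<le> (\<Sum>i\<in>UNIV. \<Sum>j\<in>UNIV. B i j) * norm y"
      using norm_matrix_vector_le_sum order_trans by blast
  qed
  then have bdd: "bdd_above ((\<lambda>s. onorm ((*v) (F s))) ` {s. 0 < Re s})"
    by (intro bdd_aboveI2) auto
  have "onorm ((*v) (F s)) \<le> Hinf_norm F"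
    unfolding Hinf_norm_def by (rule cSUP_upper[OF _ bdd]) (use s in simp)
  then show ?thesis
    using onorm[OF lin, of s y] mult_right_mono[of "onorm ((*v) (F s))" "Hinf_norm F" "norm y"] by simp
qed

text \<open>The entries of the inverse are bounded by \<open>1 / c\<close>, which bounds the determinant of the inverse by
the Leibniz formula.\<close>

lemma cmod_det_lower_bound:
  fixes M :: "complex^'n^'n"
  assumes c: "0 < c" and M: "\<And>y. c * norm y \<le> norm (M *v y)"
  shows "c ^ CARD('n) / fact CARD('n) \<le> cmod (det M)"
proof -
  have "inj ((*v) M)"
  proof (rule injI)
    fix x y assume "M *v x = M *v y"
    then have "M *v (x - y) = 0" by (simp add: matrix_vector_mult_diff_distrib)
    then show "x = y" using M[of "x - y"] c by (simp add: mult_le_0_iff)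
  qed
  then obtain B where B: "B ** M = mat 1" using matrix_left_invertible_injective by blast
  then have MB: "M ** B = mat 1" using matrix_left_right_inverse by blast
  have ent: "cmod (B $ i $ j) \<le> 1 / c" for i j
  proof -
    have "M *v (B *v axis j 1) = axis j 1" by (simp add: matrix_vector_mul_assoc MB)
    then have "c * norm (B *v axis j 1) \<le> 1" using M[of "B *v axis j 1"] by simp
    moreover have "(B *v axis j 1) $ i = B $ i $ j"
      by (simp add: matrix_vector_mult_def axis_def if_distrib cong: if_cong)
    then have "cmod (B $ i $ j) \<le> norm (B *v axis j 1)"
      using Finite_Cartesian_Product.norm_nth_le[of "B *v axis j 1" i] by simp
    then have "c * cmod (B $ i $ j) \<le> c * norm (B *v axis j 1)"
      using c by simp
    ultimately have "c * cmod (B $ i $ j) \<le> 1" by linarith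
    then show ?thesis using c by (simp add: pos_le_divide_eq mult.commute)
  qed
  have "cmod (det B) \<le> (\<Sum>p | p permutes (UNIV :: 'n set). cmod (of_int (sign p) * (\<Prod>i\<in>UNIV. B $ i $ p i)))"
    unfolding det_def by (rule norm_sum)
  also have "\<dots> \<le> (\<Sum>p | p permutes (UNIV :: 'n set). (1 / c) ^ CARD('n))"
  proof (rule sum_mono)
    fix p :: "'n \<Rightarrow> 'n"
    have "cmod (of_int (sign p)) = 1" by (simp add: sign_def)
    moreover have "(\<Prod>i\<in>UNIV. cmod (B $ i $ p i)) \<le> (\<Prod>i\<in>(UNIV :: 'n set). 1 / c)"
      by (intro prod_mono) (auto simp: ent)
    ultimately show "cmod (of_int (sign p) * (\<Prod>i\<in>UNIV. B $ i $ p i)) \<le> (1 / c) ^ CARD('n)"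
      by (simp add: norm_mult prod_norm[symmetric])
  qed
  also have "\<dots> = fact CARD('n) * (1 / c) ^ CARD('n)"
    by (simp add: card_permutations)
  finally have B_le: "cmod (det B) \<le> fact CARD('n) / c ^ CARD('n)" by (simp add: power_divide)
  have "cmod (det M) * cmod (det B) = 1"
    using arg_cong[OF MB, of det] by (simp add: det_mul norm_mult[symmetric])
  then have "1 \<le> cmod (det M) * (fact CARD('n) / c ^ CARD('n))"
    using B_le by (metis mult_left_mono norm_ge_zero)
  then show ?thesis using c by (simp add: field_simps)
qed

text \<open>Cramer's rule: the determinant is a proper stable function that is bounded away from zero, so its
reciprocal is proper and stable as well.\<close>

lemma proper_stable_solution:
  fixes M :: "complex \<Rightarrow> complex^'n^'n" and U :: "complex \<Rightarrow> complex^'n"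
  assumes M: "\<And>i j. proper_stable (\<lambda>s. M s $ i $ j)" and U: "\<And>i. proper_stable (\<lambda>s. U s $ i)"
    and c: "0 < c" "\<And>s y. 0 < Re s \<Longrightarrow> c * norm y \<le> norm (M s *v y)"
  obtains Z :: "complex \<Rightarrow> complex^'n" where "\<And>i. proper_stable (\<lambda>s. Z s $ i)"
    and "\<And>s y. 0 < Re s \<Longrightarrow> M s *v y = U s \<Longrightarrow> y = Z s"
proof -
  define Z where "Z s = (\<chi> k. det (\<chi> i j. if j = k then U s $ i else M s $ i $ j) / det (M s))" for s
  have det0: "c ^ CARD('n) / fact CARD('n) \<le> cmod (det (M s))" if "0 < Re s" for s
    using cmod_det_lower_bound[OF c(1)] c(2)[OF that] by blast
  have pos: "0 < c ^ CARD('n) / fact CARD('n)" using c(1) by simp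
  have inv: "proper_stable (\<lambda>s. 1 / det (M s))"
    by (rule proper_stable_inverse[OF proper_stable_det[OF M] pos det0])
  have "proper_stable (\<lambda>s. Z s $ k)" for k
  proof -
    have "proper_stable (\<lambda>s. (if j = k then U s $ i else M s $ i $ j))" for i j
      using M U by (cases "j = k") auto
    then have "proper_stable (\<lambda>s. det (\<chi> i j. if j = k then U s $ i else M s $ i $ j))"
      by (intro proper_stable_det) simp
    from proper_stable_mult[OF this inv] show ?thesis by (simp add: Z_def)
  qed
  moreover have "y = Z s" if "0 < Re s" "M s *v y = U s" for s y
  proof -
    have "det (M s) \<noteq> 0" using det0[OF that(1)] pos by auto
    from cramer[OF this, of y "U s"] show ?thesis using that(2) by (simp add: Z_def)
  qed
  ultimately show ?thesis using that by blast
qed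

section \<open>The perturbed serial consensus system\<close>

lemma matrix_sum_mult:
  fixes A :: "'i \<Rightarrow> 'a::semiring_1^'n^'m"
  shows "(\<Sum>k\<in>I. A k) ** B = (\<Sum>k\<in>I. A k ** B)"
  by (simp add: vec_eq_iff matrix_matrix_mult_def sum_distrib_right)
    (intro allI sum.swap)

lemma matrix_sum_vector:
  fixes A :: "'i \<Rightarrow> 'a::semiring_1^'n^'m"
  shows "(\<Sum>k\<in>I. A k) *v y = (\<Sum>k\<in>I. A k *v y)"
  by (simp add: vec_eq_iff matrix_vector_mult_def sum_distrib_right)
    (intro allI sum.swap)

text \<open>The small gain argument. Here \<open>S\<close> is the loop transfer matrix of the perturbations, acting on
\<open>(s + L)\<^sup>n y\<close>, and \<open>\<zeta> m\<close> is the component of its solution along the eigenvector \<open>Q $ m\<close>.\<close>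

lemma transfer_solution:
  fixes L :: "real^'v^'v" and Q :: "real^'v^'v" and d :: "'v \<Rightarrow> real"
    and \<Delta> :: "nat \<Rightarrow> complex \<Rightarrow> complex^'v^'v" and U :: "complex \<Rightarrow> complex^'v"
  assumes n: "1 \<le> n"
    and Q: "orthogonal_matrix Q" and eig: "\<And>m. L *v (Q $ m) = d m *\<^sub>R (Q $ m)"
    and d: "\<And>m. 0 \<le> d m"
    and U: "U \<in> RH_inf_vec" and \<Delta>: "\<And>k. k \<le> n \<Longrightarrow> \<Delta> k \<in> RH_inf_mat"
    and gain: "(\<Sum>k\<le>n. Hinf_norm (\<Delta> k) *
         sqrt (real k ^ k / real n ^ n * real (n - k) ^ (n - k))) < 1"
  obtains \<zeta> :: "'v \<Rightarrow> complex \<Rightarrow> complex"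
  where "\<And>m. proper_stable (\<zeta> m)"
    and "\<And>s y i. 0 < Re s \<Longrightarrow>
      matrix_pow (mat s + map_matrix complex_of_real L) n *v y =
        U s + (\<Sum>k\<le>n. \<Delta> k s ** mat (s ^ k) ** matrix_pow (map_matrix complex_of_real L) (n - k)) *v y \<Longrightarrow>
      y $ i = (\<Sum>m\<in>UNIV. of_real (Q $ m $ i) * (\<zeta> m s * (1 / (s + of_real (d m)) ^ n)))"
proof -
  let ?L = "map_matrix complex_of_real L"
  let ?b = "\<lambda>k. sqrt (real k ^ k / real n ^ n * real (n - k) ^ (n - k))"
  define \<gamma> where "\<gamma> = (\<Sum>k\<le>n. Hinf_norm (\<Delta> k) * ?b k)"
  define T where "T k s = spectral_matrix Q (\<lambda>m. modal_gain (d m) n k s)" for k s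
  define S where "S s = (\<Sum>k\<le>n. \<Delta> k s ** T k s)" for s
  have Leq: "?L = spectral_matrix Q (\<lambda>m. of_real (d m))"
    using spectral_matrix_eigen[OF Q eig] by simp
  have \<Delta>ps: "proper_stable (\<lambda>s. \<Delta> k s $ i $ j)" if "k \<le> n" for k i j
    using \<Delta>[OF that] by (simp add: RH_inf_mat_def RH_inf_imp_proper_stable)
  have Tps: "proper_stable (\<lambda>s. T k s $ i $ j)" for k i j
    unfolding T_def spectral_matrix_def
    by (simp, intro proper_stable_sum proper_stable_mult proper_stable_const proper_stable_modal_gain d)
  have Sps: "proper_stable (\<lambda>s. (mat 1 - S s) $ i $ j)" for i j
    unfolding S_def matrix_matrix_mult_def
    by (simp, intro proper_stable_diff proper_stable_const proper_stable_sum proper_stable_mult \<Delta>ps Tps) auto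
  have Snorm: "norm (S s *v y) \<le> \<gamma> * norm y" if s: "0 < Re s" for s y
  proof -
    have "norm (S s *v y) \<le> (\<Sum>k\<le>n. norm (\<Delta> k s *v (T k s *v y)))"
      unfolding S_def by (simp add: matrix_sum_vector matrix_vector_mul_assoc norm_sum)
    also have "\<dots> \<le> (\<Sum>k\<le>n. Hinf_norm (\<Delta> k) * ?b k * norm y)"
    proof (rule sum_mono)
      fix k assume "k \<in> {..n}"
      then have k: "k \<le> n" by simp
      have nn: "0 \<le> Hinf_norm (\<Delta> k)"
        using order_trans[OF norm_ge_zero norm_le_Hinf_norm[OF \<Delta>[OF k] s, of "axis undefined 1"]]
        by simp
      have "norm (\<Delta> k s *v (T k s *v y)) \<le> Hinf_norm (\<Delta> k) * norm (T k s *v y)"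
        by (rule norm_le_Hinf_norm[OF \<Delta>[OF k] s])
      also have "\<dots> \<le> Hinf_norm (\<Delta> k) * (?b k * norm y)"
        unfolding T_def
        by (intro mult_left_mono nn norm_spectral_matrix[OF Q] cmod_modal_gain_le d s k n)
      finally show "norm (\<Delta> k s *v (T k s *v y)) \<le> Hinf_norm (\<Delta> k) * ?b k * norm y"
        by (simp add: mult.assoc)
    qed
    finally show ?thesis by (simp add: \<gamma>_def sum_distrib_right)
  qed
  have lower: "(1 - \<gamma>) * norm y \<le> norm ((mat 1 - S s) *v y)" if s: "0 < Re s" for s y
  proof -
    have "(mat 1 - S s) *v y = y - S s *v y"
      by (simp add: matrix_vector_mult_diff_rdistrib)
    then show ?thesis
      using norm_triangle_ineq2[of y "S s *v y"] Snorm[OF s, of y] by (simp add: algebra_simps)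
  qed
  have Ups: "proper_stable (\<lambda>s. U s $ i)" for i
    using U by (simp add: RH_inf_vec_def RH_inf_imp_proper_stable)
  have "0 < 1 - \<gamma>" using gain by (simp add: \<gamma>_def)
  from proper_stable_solution[OF Sps Ups this lower]
  obtain Z where Z: "\<And>i. proper_stable (\<lambda>s. Z s $ i)"
    and Zu: "\<And>s y. 0 < Re s \<Longrightarrow> (mat 1 - S s) *v y = U s \<Longrightarrow> y = Z s"
    by blast
  define \<zeta> where "\<zeta> m s = (\<Sum>j\<in>UNIV. of_real (Q $ m $ j) * Z s $ j)" for m s
  show ?thesis
  proof (rule that[of \<zeta>])
    show "proper_stable (\<zeta> m)" for m
      unfolding \<zeta>_def[abs_def] by (intro proper_stable_sum proper_stable_mult proper_stable_const Z)
    fix s y i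
    assume s: "0 < Re s" and sys: "matrix_pow (mat s + ?L) n *v y =
        U s + (\<Sum>k\<le>n. \<Delta> k s ** mat (s ^ k) ** matrix_pow ?L (n - k)) *v y"
    define P where "P = spectral_matrix Q (\<lambda>m. (s + of_real (d m)) ^ n)"
    define R where "R = spectral_matrix Q (\<lambda>m. 1 / (s + of_real (d m)) ^ n)"
    have ne: "s + of_real (d m) \<noteq> 0" for m using s d[of m] by (auto simp: complex_eq_iff)
    have P: "matrix_pow (mat s + ?L) n = P"
      unfolding P_def Leq spectral_matrix_const[OF Q, symmetric] spectral_matrix_add
      by (rule spectral_matrix_pow[OF Q])
    have RP: "R ** P = mat 1"
      unfolding R_def P_def spectral_matrix_mult[OF Q]
      using ne spectral_matrix_const[OF Q, of 1] by simp
    have TP: "T k s ** P = mat (s ^ k) ** matrix_pow ?L (n - k)" if "k \<le> n" for k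
      unfolding T_def P_def Leq spectral_matrix_pow[OF Q] spectral_matrix_const[OF Q, symmetric]
        spectral_matrix_mult[OF Q]
      using modal_gain_mult_power[OF d s that] by simp
    have "S s ** P = (\<Sum>k\<le>n. \<Delta> k s ** (T k s ** P))"
      unfolding S_def by (simp add: matrix_sum_mult matrix_mul_assoc)
    also have "\<dots> = (\<Sum>k\<le>n. \<Delta> k s ** mat (s ^ k) ** matrix_pow ?L (n - k))"
      using TP by (intro sum.cong) (auto simp: matrix_mul_assoc)
    finally have SP: "S s ** P = \<dots>" .
    have "(mat 1 - S s) *v (P *v y) = U s"
      using sys unfolding P SP[symmetric]
      by (simp add: matrix_vector_mult_diff_rdistrib matrix_vector_mul_assoc[symmetric] diff_eq_eq)
    then have PZ: "P *v y = Z s" by (rule Zu[OF s])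
    have "y = R *v Z s"
      unfolding PZ[symmetric] by (simp add: matrix_vector_mul_assoc RP)
    then have "y $ i = (\<Sum>j\<in>UNIV. (\<Sum>m\<in>UNIV. of_real (Q$m$i) * (1 / (s + of_real (d m)) ^ n) * of_real (Q$m$j)) * Z s $ j)"
      by (simp add: R_def spectral_matrix_def matrix_vector_mult_def)
    also have "\<dots> = (\<Sum>m\<in>UNIV. \<Sum>j\<in>UNIV. of_real (Q$m$i) * (1 / (s + of_real (d m)) ^ n) * of_real (Q$m$j) * Z s $ j)"
      unfolding sum_distrib_right by (rule sum.swap)
    also have "\<dots> = (\<Sum>m\<in>UNIV. of_real (Q $ m $ i) * (\<zeta> m s * (1 / (s + of_real (d m)) ^ n)))"
      by (simp add: \<zeta>_def sum_distrib_left sum_distrib_right mult_ac)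
    finally show "y $ i = (\<Sum>m\<in>UNIV. of_real (Q $ m $ i) * (\<zeta> m s * (1 / (s + of_real (d m)) ^ n)))" .
  qed
qed

text \<open>For \<open>x > 0\<close> this applies with \<open>c = 0\<close> and yields decaying signals. The mode \<open>x = 0\<close> has a pole at
the origin and needs \<open>c > 0\<close>.\<close>

lemma exp_poly_transform_modal_term:
  assumes "proper_stable \<zeta>" "0 \<le> c" "- x < c" "1 \<le> n"
  shows "is_exp_poly_transform c (\<lambda>s. \<zeta> s * (1 / (s + of_real x) ^ n))"
proof -
  have "is_exp_poly_transform c (\<lambda>s. 1 / (s - (- of_real x)) ^ Suc (n - 1))"
    by (rule exp_poly_transform_monomial) (use assms in simp)
  then have "is_exp_poly_transform c (\<lambda>s. 1 / (s + of_real x) ^ n)" using assms(4) by simp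
  from exp_poly_transform_proper_stable_mult[OF assms(1) this assms(2)] show ?thesis .
qed

theorem theorem6:
  fixes n :: nat
    and E :: "('v::finite \<times> 'v) set"
    and W L :: "real^'v^'v"
    and U_ref :: "complex \<Rightarrow> complex^'v"
    and \<Delta> :: "nat \<Rightarrow> complex \<Rightarrow> complex^'v^'v"
    and x :: "real \<Rightarrow> real^'v"
    and X :: "complex \<Rightarrow> complex^'v"
    and \<sigma> :: real
  defines "Lc \<equiv> map_matrix complex_of_real L"
  assumes n: "n \<ge> 1"
    and graph: "weighted_graph E W"
    and tree: "contains_spanning_tree E"
    and laplacian: "L = graph_laplacian W"
    and symmetric: "L = transpose L"
    and U_ref: "U_ref \<in> RH_inf_vec"
    and \<Delta>: "\<And>k. k \<le> n \<Longrightarrow> \<Delta> k \<in> RH_inf_mat"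
    and continuous: "continuous_on {0<..} x"
    and \<sigma>: "0 \<le> \<sigma>"
    and laplace: "has_laplace_transform x X \<sigma>"
    and system: "\<And>s. \<sigma> < Re s \<Longrightarrow>
      matrix_pow (mat s + Lc) n *v X s =
        U_ref s + (\<Sum>k\<le>n. \<Delta> k s ** mat (s ^ k) ** matrix_pow Lc (n - k)) *v X s"
    and small_gain: "Hinf_norm (\<Delta> 0) + Hinf_norm (\<Delta> n) +
      (\<Sum>k=1..n-1. Hinf_norm (\<Delta> k) *
         sqrt (real k ^ k / real n ^ n * real (n - k) ^ (n - k))) < 1"
  shows "achieves_consensus n x"
proof -
  let ?b = "\<lambda>k. sqrt (real k ^ k / real n ^ n * real (n - k) ^ (n - k))"
  have gain: "(\<Sum>k\<le>n. Hinf_norm (\<Delta> k) * ?b k) < 1"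
  proof -
    \<comment> \<open>With \<open>0 ^ 0 = 1\<close> the weights of \<open>\<Delta> 0\<close> and \<open>\<Delta> n\<close> fit the general formula.\<close>
    have "{..n} = insert 0 (insert n {1..n-1})" using n by auto
    then have "(\<Sum>k\<le>n. Hinf_norm (\<Delta> k) * ?b k) = Hinf_norm (\<Delta> 0) * ?b 0 + Hinf_norm (\<Delta> n) * ?b n
        + (\<Sum>k=1..n-1. Hinf_norm (\<Delta> k) * ?b k)"
      using n by simp
    then show ?thesis using small_gain n by simp
  qed
  obtain Q d where Q: "orthogonal_matrix Q" and eig: "\<And>m. L *v (Q $ m) = d m *\<^sub>R (Q $ m)"
    using symmetric_matrix_diagonalizable[of L] symmetric by metis
  have Q1: "(Q $ m) \<bullet> (Q $ m) = 1" for m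
    using orthogonal_matrix_sums(2)[OF Q, of m m] by (simp add: inner_vec_def)
  have d: "0 \<le> d m" for m
    using laplacian_psd[OF graph laplacian symmetric, of "Q $ m"] by (simp add: eig Q1)
  have const: "Q $ m $ i = Q $ m $ j" if "d m = 0" for m i j
    by (rule laplacian_kernel_constant[OF graph laplacian symmetric tree]) (simp add: eig that)
  obtain \<zeta> where \<zeta>: "\<And>m. proper_stable (\<zeta> m)"
    and sol: "\<And>s y i. 0 < Re s \<Longrightarrow>
      matrix_pow (mat s + Lc) n *v y =
        U_ref s + (\<Sum>k\<le>n. \<Delta> k s ** mat (s ^ k) ** matrix_pow Lc (n - k)) *v y \<Longrightarrow>
      y $ i = (\<Sum>m\<in>UNIV. of_real (Q $ m $ i) * (\<zeta> m s * (1 / (s + of_real (d m)) ^ n)))"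
  proof (rule transfer_solution[OF n Q eig d U_ref \<Delta> gain, folded Lc_def], goal_cases)
    case (2 \<zeta>)
    show ?case by (rule 2(1)[OF 2(2)]) (erule (1) 2(3))
  qed
  define F where "F m s = \<zeta> m s * (1 / (s + of_real (d m)) ^ n)" for m s
  have X: "X s $ i = (\<Sum>m\<in>UNIV. of_real (Q $ m $ i) * F m s)" if "\<sigma> < Re s" for s i
    unfolding F_def using sol[OF _ system[OF that], of i] that \<sigma> by simp
  have lap: "((\<lambda>t. exp (- s * of_real t) * of_real (x t $ i)) has_integral X s $ i) {0..}" if "\<sigma> < Re s" for s i
    using laplace that unfolding has_laplace_transform_def by blast
  have cont: "continuous_on {0<..} (\<lambda>t. x t $ i)" for i
    by (intro continuous_intros continuous)
  \<comment> \<open>The kernel of \<open>L\<close> contributes poles at the origin, so the abscissa has to be positive; any positive value would do.\<close>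
  have tr1: "is_exp_poly_transform 1 (\<lambda>s. \<Sum>m\<in>UNIV. of_real (Q $ m $ i) * F m s)" for i
    unfolding F_def
    by (intro exp_poly_transform_sum exp_poly_transform_scale exp_poly_transform_modal_term \<zeta> n) (use d in \<open>auto intro: less_le_trans[of _ 0] simp: le_less_trans\<close>)
  have smooth: "(deriv ^^ k) (\<lambda>t. x t $ i) differentiable at t" if "0 < t" for k i t
  proof -
    obtain f G where "exp_poly 1 f G" "\<And>t. 0 < t \<Longrightarrow> x t $ i = Re (f t)"
      using signal_eq_exp_poly[OF cont lap tr1 X] by blast
    from iterated_deriv_exp_poly(2)[where g = "\<lambda>t. x t $ i", OF this that] show ?thesis .
  qed
  \<comment> \<open>In a difference of two components the kernel of \<open>L\<close> cancels.\<close>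
  have tr0: "is_exp_poly_transform 0 (\<lambda>s. \<Sum>m\<in>UNIV. of_real (Q $ m $ i - Q $ m $ j) * F m s)" for i j
  proof (rule exp_poly_transform_sum)
    fix m
    show "is_exp_poly_transform 0 (\<lambda>s. of_real (Q $ m $ i - Q $ m $ j) * F m s)"
    proof (cases "d m = 0")
      case True
      then show ?thesis using const[OF True, of i j] by (simp add: exp_poly_transform_zero)
    next
      case False
      then show ?thesis
        unfolding F_def using d[of m]
        by (intro exp_poly_transform_scale exp_poly_transform_modal_term \<zeta> n) auto
    qed
  qed
  have decay: "((\<lambda>t. \<bar>(deriv ^^ k) (\<lambda>t. x t $ i) t - (deriv ^^ k) (\<lambda>t. x t $ j) t\<bar>) \<longlongrightarrow> 0) at_top" for k i j
  proof -
    have cont': "continuous_on {0<..} (\<lambda>t. x t $ i - x t $ j)"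
      by (intro continuous_intros continuous)
    have lap': "((\<lambda>t. exp (- s * of_real t) * of_real (x t $ i - x t $ j)) has_integral X s $ i - X s $ j) {0..}"
      if "\<sigma> < Re s" for s
      using has_integral_diff[OF lap[OF that, of i] lap[OF that, of j]] by (simp add: right_diff_distrib)
    have X': "X s $ i - X s $ j = (\<Sum>m\<in>UNIV. of_real (Q $ m $ i - Q $ m $ j) * F m s)" if "\<sigma> < Re s" for s
      by (simp add: X[OF that] sum_subtractf[symmetric] left_diff_distrib)
    obtain f G where "exp_poly 0 f G" "\<And>t. 0 < t \<Longrightarrow> x t $ i - x t $ j = Re (f t)"
      using signal_eq_exp_poly[OF cont' lap' tr0 X'] by blast
    from iterated_deriv_exp_poly(1)[where g = "\<lambda>t. x t $ i - x t $ j", OF this]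
    obtain f' F' where f': "exp_poly 0 f' F'"
      "\<forall>t>0. (deriv ^^ k) (\<lambda>t. x t $ i - x t $ j) t = Re (f' t)" by blast
    have "(f' \<longlongrightarrow> 0) at_top" by (rule exp_poly_tendsto_0[OF f'(1)])
    then have "((\<lambda>t. \<bar>Re (f' t)\<bar>) \<longlongrightarrow> \<bar>Re 0\<bar>) at_top"
      by (intro tendsto_rabs tendsto_Re)
    then have "((\<lambda>t. \<bar>Re (f' t)\<bar>) \<longlongrightarrow> 0) at_top" by simp
    then show ?thesis
    proof (rule Lim_transform_eventually)
      show "\<forall>\<^sub>F t in at_top. \<bar>Re (f' t)\<bar> = \<bar>(deriv ^^ k) (\<lambda>t. x t $ i) t - (deriv ^^ k) (\<lambda>t. x t $ j) t\<bar>"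
        using eventually_gt_at_top[of 0]
      proof eventually_elim
        case (elim t)
        show ?case
          using f'(2) elim iterated_deriv_diff[OF smooth smooth elim, of k i j] by simp
      qed
    qed
  qed
  show ?thesis
    unfolding achieves_consensus_def using smooth decay by blast
qed

end
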